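(* Assume $\mathfrak b\le\operatorname{cov}(\mathcal M)$. Let $\overline{\mathbb N}^{\uparrow\mathbb N}$ be identified with a subspace of $\mathbb R$ via any topological embedding. Let $\mathcal F$ be the Fréchet filter (so that $\mathfrak b(\mathcal F)=\mathfrak b$), let $S=\{f_\alpha:\alpha<\mathfrak b\}$ be any $\mathfrak b(\mathcal F)$-scale, and let $X=S\cup Q\subseteq\overline{\mathbb N}^{\uparrow\mathbb N}\subseteq\mathbb R$. Then the subfield $\mathbb Q(X)$ of $\mathbb R$ generated by $\mathbb Q\cup X$ satisfies $\mathsf S_1(\Omega,\Omega^{gp})$ (equivalently, all finite powers of $\mathbb Q(X)$ satisfy the Hurewicz property as well as Rothberger's property $\mathsf S_1(\mathcal O,\mathcal O)$).
   Context: $\mathbb N=\{0,1,2,\dots\}$, discrete; $\mathbb N^{\mathbb N}$ has the product topology. The Fréchet filter is the family of all cofinite subsets of $\mathbb N$. For $f,g\in\mathbb N^{\mathbb N}$, $f\le^*g$ means $f(n)\le g(n)$ for all but finitely many $n$; for $\mathcal F$ the Fréchet filter, $\le_{\mathcal F}$ is $\le^*$. A set $Y\subseteq\mathbb N^{\mathbb N}$ is bounded (with respect to $\le^*$) if there is $g\in\mathbb N^{\mathbb N}$ with $f\le^*g$ for all $f\in Y$; otherwise it is unbounded. $\mathfrak b$ is the minimal cardinality of an unbounded subset of $\mathbb N^{\mathbb N}$. $\operatorname{cov}(\mathcal M)$ is the minimal cardinality of a cover of the real line by meager sets. $\mathbb N^{\uparrow\mathbb N}$ is the set of (strictly) increasing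 elements of $\mathbb N^{\mathbb N}$. For $\mathcal F$ the Fréchet filter, a $\mathfrak b(\mathcal F)$-scale is an unbounded family $S=\{f_\alpha:\alpha<\mathfrak b\}\subseteq\mathbb N^{\uparrow\mathbb N}$ with $f_\alpha\le^*f_\beta$ for all $\alpha<\beta<\mathfrak b$. A space has the Hurewicz property if each of its continuous images in $\mathbb N^{\mathbb N}$ is bounded with respect to $\le^*$. $\overline{\mathbb N}=\mathbb N\cup\{\infty\}$ is the one-point compactification of $\mathbb N$. $\overline{\mathbb N}^{\uparrow\mathbb N}$ is the subspace of the product $\overline{\mathbb N}^{\mathbb N}$ consisting of the nondecreasing $f$ such that $f(n)<f(n+1)$ whenever $f(n)<\infty$; it is homeomorphic to the Cantor space. $Q$ (not to be confused with the rationals $\mathbb Q$) is the countable set of all $f\in\overline{\mathbb N}^{\uparrow\mathbb N}$ that take the value $\infty$; thus $\overline{\mathbb N}^{\uparrow\mathbb N}=Q\cup\mathbb N^{\uparrow\mathbb N}$. For a space $Y$: $\mathcal O$ is the collection of all open covers of $Y$. An open cover $\mathcal U$ of $Y$ is an $\omega$-cover if $Y\notin\mathcal U$ and each finite $F\subseteq Y$ is contained in some $U\in\mathcal U$; $\Omega$ is the collection of countable open $\omega$-covers of $Y$. $\Omega^{gp}$ is the collection of $\mathcal U\in\Omega$ for which there is a partition $\mathcal U=\bigcup_n\mathcal F_n$ into finite sets such that for each finite $F\subseteq Y$ and all but finitely many $n$, there is $U\in\mathcal F_n$ with $F\subseteq U$. For collections $\mathscr A,\mathscr B$ of covers of $Y$,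 $\mathsf S_1(\mathscr A,\mathscr B)$ says: for each sequence $\{\mathcal U_n\}_{n\in\mathbb N}$ of members of $\mathscr A$, there exist $U_n\in\mathcal U_n$, $n\in\mathbb N$, such that $\{U_n:n\in\mathbb N\}\in\mathscr B$. *)

theory Defs
  imports
    "HOL-Analysis.Analysis"
    "HOL-Algebra.Generated_Fields"
    "HOL-Algebra.Algebraic_Closure_Type"
begin

unbundle cardinal_syntax

section \<open>Bounded families and the cardinals \<open>\<bb>\<close> and \<open>cov(\<M>)\<close>\<close>

definition le_star :: "(nat \<Rightarrow> nat) \<Rightarrow> (nat \<Rightarrow> nat) \<Rightarrow> bool"  (infix \<open>\<le>\<^sup>*\<close> 50)
  where "f \<le>\<^sup>* g \<longleftrightarrow> (\<forall>\<^sub>F n in cofinite. f n \<le> g n)"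

definition bounded_star :: "(nat \<Rightarrow> nat) set \<Rightarrow> bool"
  where "bounded_star Y \<longleftrightarrow> (\<exists>g. \<forall>f\<in>Y. f \<le>\<^sup>* g)"

definition nowhere_dense :: "'a::topological_space set \<Rightarrow> bool"
  where "nowhere_dense A \<longleftrightarrow> interior (closure A) = {}"

definition meager :: "'a::topological_space set \<Rightarrow> bool"
  where "meager A \<longleftrightarrow> (\<exists>N. countable N \<and> (\<forall>B\<in>N. nowhere_dense B) \<and> A = \<Union>N)"

text \<open>
  The minimal cardinality of a member of \<open>\<A>\<close>. As for \<open>card_of\<close>, a cardinal is represented by a
  well-order of initial order type, here on the chosen member of minimal cardinality.
\<close>

definition min_card :: "'a set set \<Rightarrow> 'a rel"
  where "min_card \<A> = |SOME A. A \<in> \<A> \<and> (\<forall>B\<in>\<A>. |A| \<le>o |B| )|"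

lemma min_card_attained:
  assumes "\<A> \<noteq> {}"
  shows "\<exists>A\<in>\<A>. min_card \<A> = |A| \<and> (\<forall>B\<in>\<A>. |A| \<le>o |B| )"
proof -
  have "\<exists>r\<in>card_of ` \<A>. \<forall>r'\<in>card_of ` \<A>. r \<le>o r'"
    using assms by (intro exists_minim_Card_order) (auto simp: card_of_Card_order)
  then have "\<exists>A. A \<in> \<A> \<and> (\<forall>B\<in>\<A>. |A| \<le>o |B| )" by auto
  from someI_ex[OF this] show ?thesis unfolding min_card_def by blast
qed

definition bounding_number :: "(nat \<Rightarrow> nat) rel"  (\<open>\<bb>\<close>)
  where "\<bb> = min_card {Y. \<not> bounded_star Y}"

definition cov_meager :: "real set rel"
  where "cov_meager = min_card {\<C>. (\<forall>A\<in>\<C>. meager A) \<and> \<Union>\<C> = UNIV}"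

lemma unbounded_exists: "{Y. \<not> bounded_star Y} \<noteq> {}"
proof -
  have "\<not> bounded_star UNIV"
  proof
    assume "bounded_star UNIV"
    then obtain g where "(\<lambda>n. Suc (g n)) \<le>\<^sup>* g" unfolding bounded_star_def by blast
    then show False by (simp add: le_star_def eventually_cofinite)
  qed
  then show ?thesis by blast
qed

lemma meager_cover_exists: "{\<C>. (\<forall>A\<in>\<C>. meager (A :: real set)) \<and> \<Union>\<C> = UNIV} \<noteq> {}"
proof -
  have "meager {x}" for x :: real
    unfolding meager_def nowhere_dense_def by (rule exI[of _ "{{x}}"]) simp
  then have "range (\<lambda>x::real. {x}) \<in> {\<C>. (\<forall>A\<in>\<C>. meager A) \<and> \<Union>\<C> = UNIV}" by auto
  then show ?thesis by blast
qed

text \<open>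
  The indices \<open>\<alpha> < \<bb>\<close> are the elements of the field of the well-order \<open>\<bb>\<close>, and \<open>\<alpha> < \<beta>\<close> is its
  strict part.
\<close>

definition b_scale :: "(nat \<Rightarrow> nat) set \<Rightarrow> bool"
  where "b_scale S \<longleftrightarrow> \<not> bounded_star S \<and>
    (\<exists>f. S = f ` Field \<bb> \<and> (\<forall>\<alpha>\<in>Field \<bb>. strict_mono (f \<alpha>)) \<and>
      (\<forall>\<alpha> \<beta>. (\<alpha>, \<beta>) \<in> \<bb> \<and> \<alpha> \<noteq> \<beta> \<longrightarrow> f \<alpha> \<le>\<^sup>* f \<beta>))"

section \<open>The space of increasing extended sequences\<close>

text \<open>
  The order topology of \<^typ>\<open>enat\<close> is that of the one-point compactification of the discrete space
  \<open>\<nat>\<close>; functions carry the product topology.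
\<close>

definition ext_incr :: "(nat \<Rightarrow> enat) set"
  where "ext_incr = {f. mono f \<and> (\<forall>n. f n < \<infinity> \<longrightarrow> f n < f (Suc n))}"

definition Q_inf :: "(nat \<Rightarrow> enat) set"
  where "Q_inf = {f \<in> ext_incr. \<exists>n. f n = \<infinity>}"

definition to_ext :: "(nat \<Rightarrow> nat) \<Rightarrow> nat \<Rightarrow> enat"
  where "to_ext f = (\<lambda>n. enat (f n))"

section \<open>Covering properties\<close>

definition open_covers :: "'a topology \<Rightarrow> 'a set set set"
  where "open_covers Y = {\<U>. (\<forall>U\<in>\<U>. openin Y U) \<and> \<Union>\<U> = topspace Y}"

definition omega_covers :: "'a topology \<Rightarrow> 'a set set set"
  where "omega_covers Y = {\<U> \<in> open_covers Y. countable \<U> \<and> topspace Y \<notin> \<U> \<and>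
    (\<forall>F. finite F \<and> F \<subseteq> topspace Y \<longrightarrow> (\<exists>U\<in>\<U>. F \<subseteq> U))}"

text \<open>
  Empty blocks \<open>\<F> n\<close> are not excluded separately: the condition for \<open>F = {}\<close> allows only finitely
  many of them, and these can be dropped by reindexing.
\<close>

definition gp_omega_covers :: "'a topology \<Rightarrow> 'a set set set"
  where "gp_omega_covers Y = {\<U> \<in> omega_covers Y.
    \<exists>\<F> :: nat \<Rightarrow> 'a set set. disjoint_family \<F> \<and> \<U> = (\<Union>n. \<F> n) \<and> (\<forall>n. finite (\<F> n)) \<and>
      (\<forall>F. finite F \<and> F \<subseteq> topspace Y \<longrightarrow> (\<forall>\<^sub>F n in cofinite. \<exists>U\<in>\<F> n. F \<subseteq> U))}"

definition S1 :: "'a set set set \<Rightarrow> 'a set set set \<Rightarrow> bool"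
  where "S1 \<A> \<B> \<longleftrightarrow>
    (\<forall>\<U> :: nat \<Rightarrow> 'a set set. (\<forall>n. \<U> n \<in> \<A>) \<longrightarrow>
      (\<exists>U :: nat \<Rightarrow> 'a set. (\<forall>n. U n \<in> \<U> n) \<and> range U \<in> \<B>))"

definition hurewicz_property :: "'a topology \<Rightarrow> bool"
  where "hurewicz_property Y \<longleftrightarrow>
    (\<forall>\<phi> :: 'a \<Rightarrow> nat \<Rightarrow> nat. continuous_map Y euclidean \<phi> \<longrightarrow> bounded_star (\<phi> ` topspace Y))"

definition rothberger_property :: "'a topology \<Rightarrow> bool"
  where "rothberger_property Y \<longleftrightarrow> S1 (open_covers Y) (open_covers Y)"

definition finite_power :: "'a topology \<Rightarrow> nat \<Rightarrow> (nat \<Rightarrow> 'a) topology"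
  where "finite_power Y k = product_topology (\<lambda>_. Y) {..<k}"

section \<open>The generated subfield of the reals\<close>

definition rat_adjoin :: "real set \<Rightarrow> real set"
  where "rat_adjoin A = generate_field (ring_of_type_algebra :: real ring) (\<rat> \<union> A)"

end

theory Submission
  imports Defs "HOL-Algebra.Free_Abelian_Groups"
begin

text \<open>
  The Hurewicz and Rothberger properties are handled together: from open covers \<open>\<U> n\<close> one selects
  \<open>U n \<in> \<U> n\<close> and a function \<open>N\<close> such that every point lies in some \<open>U n\<close> with \<open>j \<le> n < N j\<close>, for
  almost all \<open>j\<close>. This combined property passes to countable unions and continuous images, and if all
  finite powers have it then \<open>S\<^sub>1(\<Omega>, \<Omega>\<^sup>g\<^sup>p)\<close> follows.

  Put \<open>Y = S \<union> Q\<close>. For fewer than \<open>\<bb>\<close> tuples \<open>d\<close>, the combined property of the set of tuples that agree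
  with some \<open>d\<close> outside a finite index set \<open>I\<close> and have entries in \<open>Y\<close> on \<open>I\<close> is proved by induction
  on \<open>I\<close>. The tuples with entries in \<open>Q\<close> on \<open>I\<close> are fewer than \<open>cov(\<M>)\<close>, so one selection catches
  each of them infinitely often. By compactness there are numbers \<open>p d j\<close> such that the sets
  \<open>U n\<close>, \<open>j \<le> n < p d j\<close>, contain all tuples over \<open>d\<close> whose entries on \<open>I\<close> exceed \<open>p d j\<close> at \<open>j\<close>. The
  functions \<open>p d\<close> have a common bound \<open>g\<close>; some \<open>f\<^sub>\<alpha>\<close> in the scale exceeds \<open>g\<close> infinitely often, and so
  does every later one. This takes care of all tuples except those with an entry \<open>f\<^sub>\<beta>\<close>, \<open>\<beta> < \<alpha>\<close>, and these
  are covered by the induction hypothesis.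

  The field is a countable union of continuous images of finite powers of \<open>Y\<close>.
\<close>

section \<open>Spaces with the Hurewicz and Rothberger properties\<close>

text \<open>The windows from \<open>j\<close> to \<open>N j\<close> start at every \<open>j\<close>
  and may overlap, so \<open>N\<close> can be enlarged freely and subsequences combined; disjoint
  blocks arise later by iterating \<open>N\<close>.\<close>

definition selectable :: "(nat \<Rightarrow> 'a set set) \<Rightarrow> 'a set \<Rightarrow> bool"
  where "selectable \<U> Z \<longleftrightarrow> (\<exists>U N. (\<forall>n. U n \<in> \<U> n) \<and>
    (\<forall>z\<in>Z. \<forall>\<^sub>F j in sequentially. \<exists>n. j \<le> n \<and> n < N j \<and> z \<in> U n))"

text \<open>Nonemptiness of \<open>\<U> n\<close> matters for the empty space, where a member must
  still be selected.\<close>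

definition hr_space :: "'a topology \<Rightarrow> bool"
  where "hr_space T \<longleftrightarrow> (\<forall>\<U> :: nat \<Rightarrow> 'a set set.
    (\<forall>n. \<U> n \<noteq> {} \<and> (\<forall>U\<in>\<U> n. openin T U) \<and> topspace T \<subseteq> \<Union>(\<U> n)) \<longrightarrow>
      selectable \<U> (topspace T))"

section \<open>Permanence under countable unions and continuous images\<close>

lemma selectableE:
  assumes "selectable \<U> Z"
  obtains U N where "\<And>n. U n \<in> \<U> n"
    and "\<And>z. z \<in> Z \<Longrightarrow> \<forall>\<^sub>F j in sequentially. \<exists>n. j \<le> n \<and> n < N j \<and> z \<in> U n"
  using assms unfolding selectable_def by blast

lemma hr_spaceD:
  assumes "hr_space T" "\<And>n. \<U> n \<noteq> {}" "\<And>n U. U \<in> \<U> n \<Longrightarrow> openin T U"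
    and "\<And>n. topspace T \<subseteq> \<Union>(\<U> n)"
  shows "selectable \<U> (topspace T)"
  using assms(1)[unfolded hr_space_def, rule_format, of \<U>] assms(2-4) by simp

lemma selectable_image:
  assumes "selectable \<V> Z" and "\<And>n V. V \<in> \<V> n \<Longrightarrow> \<exists>U\<in>\<U> n. f ` (V \<inter> Z) \<subseteq> U"
  shows "selectable \<U> (f ` Z)"
proof -
  obtain V N where V: "\<And>n. V n \<in> \<V> n"
    and N: "\<And>z. z \<in> Z \<Longrightarrow> \<forall>\<^sub>F j in sequentially. \<exists>n. j \<le> n \<and> n < N j \<and> z \<in> V n"
    using assms(1) by (rule selectableE) (rule that)
  have "\<forall>n. \<exists>U. U \<in> \<U> n \<and> f ` (V n \<inter> Z) \<subseteq> U" using assms(2) V by blast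
  then obtain U where U: "\<And>n. U n \<in> \<U> n" "\<And>n. f ` (V n \<inter> Z) \<subseteq> U n" by metis
  have "\<forall>\<^sub>F j in sequentially. \<exists>n. j \<le> n \<and> n < N j \<and> f z \<in> U n" if "z \<in> Z" for z
    using N[OF that] by (rule eventually_mono) (use U(2) that in blast)
  then show ?thesis unfolding selectable_def using U(1) by blast
qed

lemma selectable_subset: "selectable \<U> Z \<Longrightarrow> Z' \<subseteq> Z \<Longrightarrow> selectable \<U> Z'"
  unfolding selectable_def by blast

text \<open>The pairing function splits the covers into subsequences, the i-th serving
  \<open>Z i\<close>. The window at j looks only at those \<open>Z i\<close> with i \<le> j, so its
  end \<open>M j\<close> is finite; a point of \<open>Z i\<close> may be missed for j < i, which is
  harmless.\<close>

lemma selectable_Union: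
  assumes "\<And>i. selectable (\<lambda>n. \<U> (prod_encode (i, n))) (Z i)"
  shows "selectable \<U> (\<Union>i. Z i)"
proof -
  define P where "P i U N \<longleftrightarrow> (\<forall>n. U n \<in> \<U> (prod_encode (i, n))) \<and>
      (\<forall>z\<in>Z i. \<forall>\<^sub>F j in sequentially. \<exists>n. j \<le> n \<and> n < N j \<and> z \<in> U n)" for i U and N :: "nat \<Rightarrow> nat"
  have "\<forall>i. \<exists>U N. P i U N"
    using assms unfolding selectable_def P_def by (rule allI)
  then obtain U N where "\<And>i. P i (U i) (N i)" by metis
  then have U: "\<And>i n. U i n \<in> \<U> (prod_encode (i, n))"
    and N: "\<And>i z. z \<in> Z i \<Longrightarrow> \<forall>\<^sub>F j in sequentially. \<exists>n. j \<le> n \<and> n < N i j \<and> z \<in> U i n"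
    unfolding P_def by auto
  define V where "V k = (case prod_decode k of (i, n) \<Rightarrow> U i n)" for k
  have "\<exists>M. \<forall>i\<le>j. \<forall>n<N i j. prod_encode (i, n) < M" for j
  proof -
    have "finite (\<Union>i\<le>j. (\<lambda>n. prod_encode (i, n)) ` {..<N i j})" by simp
    then obtain M where "\<forall>k \<in> (\<Union>i\<le>j. (\<lambda>n. prod_encode (i, n)) ` {..<N i j}). k < M"
      using finite_nat_set_iff_bounded by blast
    then show ?thesis by blast
  qed
  then obtain M where M: "\<And>j i n. i \<le> j \<Longrightarrow> n < N i j \<Longrightarrow> prod_encode (i, n) < M j"
    by metis
  have "V k \<in> \<U> k" for k
    using U[of "fst (prod_decode k)" "snd (prod_decode k)"] by (simp add: V_def split_beta)
  moreover have "\<forall>\<^sub>F j in sequentially. \<exists>n. j \<le> n \<and> n < M j \<and> z \<in> V n" if "z \<in> Z i" for z i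
    using N[OF that] eventually_ge_at_top[of i]
  proof eventually_elim
    case (elim j)
    then obtain n where n: "j \<le> n" "n < N i j" "z \<in> U i n" by blast
    have "z \<in> V (prod_encode (i, n))" using n(3) by (simp add: V_def)
    moreover have "j \<le> prod_encode (i, n)" using n(1) le_prod_encode_2 order_trans by blast
    ultimately show ?case using M elim(2) n(2) by blast
  qed
  ultimately show ?thesis unfolding selectable_def by blast
qed

lemma selectable_Un:
  assumes "selectable (\<lambda>n. \<U> (prod_encode (0, n))) Z"
    and "\<And>i. selectable (\<lambda>n. \<U> (prod_encode (Suc i, n))) (Z' i)"
  shows "selectable \<U> (Z \<union> (\<Union>i. Z' i))"
proof -
  have "selectable \<U> (\<Union>i. case i of 0 \<Rightarrow> Z | Suc i \<Rightarrow> Z' i)"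
    using assms by (intro selectable_Union) (simp split: nat.split)
  moreover have "Z \<union> (\<Union>i. Z' i) \<subseteq> (\<Union>i. case i of 0 \<Rightarrow> Z | Suc i \<Rightarrow> Z' i)"
  proof
    fix z assume "z \<in> Z \<union> (\<Union>i. Z' i)"
    then consider "z \<in> Z" | i where "z \<in> Z' i" by blast
    then show "z \<in> (\<Union>i. case i of 0 \<Rightarrow> Z | Suc i \<Rightarrow> Z' i)"
    proof cases
      case 1
      then show ?thesis by (intro UN_I[of 0]) auto
    next
      case (2 i)
      then show ?thesis by (intro UN_I[of "Suc i"]) auto
    qed
  qed
  ultimately show ?thesis by (rule selectable_subset)
qed

text \<open>Covers are pulled back along \<open>f\<close>. They need only cover the image, so a part
  of a larger space can be treated with the covers of that space.\<close>

lemma hr_space_continuous_image: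
  assumes "hr_space T" "continuous_map T T' f"
    and \<U>: "\<And>n. \<U> n \<noteq> {}" "\<And>n U. U \<in> \<U> n \<Longrightarrow> openin T' U" "\<And>n. f ` topspace T \<subseteq> \<Union>(\<U> n)"
  shows "selectable \<U> (f ` topspace T)"
proof (rule selectable_image)
  let ?V = "\<lambda>n. (\<lambda>U. {x \<in> topspace T. f x \<in> U}) ` \<U> n"
  show "selectable ?V (topspace T)"
  proof (rule hr_spaceD[OF assms(1)])
    show "openin T V" if "V \<in> ?V n" for n V
      using that openin_continuous_map_preimage[OF assms(2) \<U>(2)] by blast
    show "topspace T \<subseteq> \<Union>(?V n)" for n using \<U>(3)[of n] by blast
  qed (simp add: \<U>(1))
qed blast

lemma hr_space_countable_Union_images:
  fixes f :: "'i::countable \<Rightarrow> 'a \<Rightarrow> 'b"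
  assumes "hr_space T" "\<And>i. continuous_map T T' (f i)" "topspace T' = (\<Union>i. f i ` topspace T)"
  shows "hr_space T'"
  unfolding hr_space_def
proof (intro allI impI)
  fix \<U> :: "nat \<Rightarrow> 'b set set"
  assume \<U>: "\<forall>n. \<U> n \<noteq> {} \<and> (\<forall>U\<in>\<U> n. openin T' U) \<and> topspace T' \<subseteq> \<Union>(\<U> n)"
  have "selectable (\<lambda>n. \<U> (prod_encode (m, n))) (f (from_nat m) ` topspace T)" for m
  proof (rule hr_space_continuous_image[OF assms(1,2)])
    show "f (from_nat m) ` topspace T \<subseteq> \<Union>(\<U> (prod_encode (m, n)))" for n
      using \<U> assms(3) by (metis UN_upper UNIV_I order_trans)
  qed (use \<U> in auto)
  then have "selectable \<U> (\<Union>m. f (from_nat m) ` topspace T)" by (rule selectable_Union)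
  moreover have "(\<Union>m. f (from_nat m) ` topspace T) = (\<Union>i. f i ` topspace T)"
  proof
    show "(\<Union>i. f i ` topspace T) \<subseteq> (\<Union>m. f (from_nat m) ` topspace T)"
    proof
      fix y assume "y \<in> (\<Union>i. f i ` topspace T)"
      then obtain i where "y \<in> f i ` topspace T" by blast
      then have "y \<in> f (from_nat (to_nat i)) ` topspace T" by simp
      then show "y \<in> (\<Union>m. f (from_nat m) ` topspace T)" by blast
    qed
  qed blast
  ultimately show "selectable \<U> (topspace T')" using assms(3) by simp
qed

lemma hr_space_countable_Union:
  fixes Z :: "nat \<Rightarrow> 'a set"
  assumes "\<And>i. hr_space (subtopology T (Z i))"
  shows "hr_space (subtopology T (\<Union>i. Z i))"
  unfolding hr_space_def
proof (intro allI impI)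
  fix \<U> :: "nat \<Rightarrow> 'a set set"
  assume \<U>: "\<forall>n. \<U> n \<noteq> {} \<and> (\<forall>U\<in>\<U> n. openin (subtopology T (\<Union>i. Z i)) U) \<and>
    topspace (subtopology T (\<Union>i. Z i)) \<subseteq> \<Union>(\<U> n)"
  have "selectable (\<lambda>n. \<U> (prod_encode (i, n))) (id ` topspace (subtopology T (Z i)))" for i
  proof (rule hr_space_continuous_image[OF assms[of i]])
    show "continuous_map (subtopology T (Z i)) (subtopology T (\<Union>i. Z i)) id"
      by (auto simp: continuous_map_in_subtopology continuous_map_from_subtopology)
    show "id ` topspace (subtopology T (Z i)) \<subseteq> \<Union>(\<U> (prod_encode (i, n)))" for n
      using \<U>[rule_format, of "prod_encode (i, n)"] by (auto simp: subset_iff)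
  qed (use \<U> in auto)
  then have "selectable \<U> (\<Union>i. id ` topspace (subtopology T (Z i)))" by (rule selectable_Union)
  moreover have "(\<Union>i. id ` topspace (subtopology T (Z i))) = topspace (subtopology T (\<Union>i. Z i))"
    by auto
  ultimately show "selectable \<U> (topspace (subtopology T (\<Union>i. Z i)))" by simp
qed

section \<open>The Rothberger and Hurewicz properties from the combined one\<close>

lemma hr_space_imp_rothberger:
  assumes "hr_space T" "topspace T \<noteq> {}"
  shows "rothberger_property T"
  unfolding rothberger_property_def S1_def
proof (intro allI impI)
  fix \<U> :: "nat \<Rightarrow> 'a set set"
  assume \<U>: "\<forall>n. \<U> n \<in> open_covers T"
  have "selectable \<U> (topspace T)"
  proof (rule hr_spaceD[OF assms(1)])
    \<comment> \<open>The empty family covers the empty space and offers nothing to select;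
      nonemptiness excludes it.\<close>
    show "\<U> n \<noteq> {}" for n
      using \<U>[rule_format, of n] assms(2) by (force simp: open_covers_def)
  qed (use \<U> in \<open>auto simp: open_covers_def\<close>)
  then obtain U N where U: "\<And>n. U n \<in> \<U> n"
    and N: "\<And>z. z \<in> topspace T \<Longrightarrow> \<forall>\<^sub>F j in sequentially. \<exists>n. j \<le> n \<and> n < N j \<and> z \<in> U n"
    by (rule selectableE) (rule that)
  have "z \<in> \<Union>(range U)" if "z \<in> topspace T" for z
    using eventually_happens[OF N[OF that]] by auto
  moreover have op: "openin T (U n)" for n using \<U>[rule_format, of n] U[of n] by (simp add: open_covers_def)
  ultimately have "range U \<in> open_covers T"
    using openin_subset[OF op] unfolding open_covers_def by blast
  then show "\<exists>U. (\<forall>n. U n \<in> \<U> n) \<and> range U \<in> open_covers T" using U by blast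
qed

text \<open>The index n catching a point is only known to lie in the window at j. Hence
  \<open>W n k\<close> bounds all coordinates i \<le> n, j among them, and the sum of the constants
  below \<open>N j\<close> is a bound at j.\<close>

lemma hr_space_imp_hurewicz:
  assumes "hr_space T"
  shows "hurewicz_property T"
  unfolding hurewicz_property_def
proof (intro allI impI)
  fix \<phi> :: "'a \<Rightarrow> nat \<Rightarrow> nat"
  assume "continuous_map T euclidean \<phi>"
  then have cont: "continuous_map T euclidean (\<lambda>y. \<phi> y i)" for i
    using continuous_map_compose[of T euclidean \<phi> euclidean "\<lambda>f. f i"]
    by (simp add: o_def continuous_on_product_coordinates)
  define W where "W n k = {y \<in> topspace T. \<forall>i\<in>{..n}. \<phi> y i \<le> k}" for n k
  have "openin T (W n k)" for n k
  proof -
    have "openin T {y \<in> topspace T. \<phi> y i \<in> {..k}}" for i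
      by (rule openin_continuous_map_preimage[OF cont]) (simp add: open_discrete)
    then have "openin T (\<Inter>i\<in>{..n}. {y \<in> topspace T. \<phi> y i \<in> {..k}})"
      by (intro openin_INT2) auto
    moreover have "(\<Inter>i\<in>{..n}. {y \<in> topspace T. \<phi> y i \<in> {..k}}) = W n k"
      by (auto simp: W_def)
    ultimately show ?thesis by simp
  qed
  moreover have W_ex: "y \<in> W n (\<Sum>i\<le>n. \<phi> y i)" if "y \<in> topspace T" for y n
    using that by (auto simp: W_def intro: member_le_sum)
  ultimately have "selectable (\<lambda>n. range (W n)) (topspace T)"
    by (intro hr_spaceD[OF assms]) (auto intro: W_ex)
  then obtain U N where U: "\<And>n. U n \<in> range (W n)"
    and N: "\<And>z. z \<in> topspace T \<Longrightarrow> \<forall>\<^sub>F j in sequentially. \<exists>n. j \<le> n \<and> n < N j \<and> z \<in> U n"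
    by (rule selectableE) (rule that)
  have "\<forall>n. \<exists>k. U n = W n k" using U by blast
  then obtain k where k: "\<And>n. U n = W n (k n)" by metis
  have "\<phi> y \<le>\<^sup>* (\<lambda>j. \<Sum>n<N j. k n)" if "y \<in> topspace T" for y
    unfolding le_star_def cofinite_eq_sequentially using N[OF that]
  proof eventually_elim
    case (elim j)
    then obtain n where n: "j \<le> n" "n < N j" "y \<in> U n" by blast
    then have "\<phi> y j \<le> k n" by (simp add: k W_def)
    also have "k n \<le> (\<Sum>n<N j. k n)" using n(2) by (intro member_le_sum) auto
    finally show ?case .
  qed
  then show "bounded_star (\<phi> ` topspace T)" unfolding bounded_star_def by blast
qed

section \<open>Groupable omega-covers\<close>

text \<open>No member of an omega-cover is the whole space, so each set chosen so far misses a
  point. Adding these points to \<open>F\<close> forces the next choice to be new.\<close>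

lemma ex_distinct_omega_cover_members:
  assumes "\<And>i. \<U> i \<in> omega_covers T" "finite F" "F \<subseteq> topspace T"
  shows "\<exists>W. (\<forall>i<m. W i \<in> \<U> i \<and> F \<subseteq> W i) \<and> inj_on W {..<m::nat}"
proof (induction m)
  case (Suc m)
  then obtain W where W: "\<And>i. i < m \<Longrightarrow> W i \<in> \<U> i \<and> F \<subseteq> W i" "inj_on W {..<m}" by blast
  have "\<exists>x. x \<in> topspace T - W i" if "i < m" for i
  proof -
    have "W i \<in> \<U> i" "topspace T \<notin> \<U> i" "\<U> i \<in> open_covers T"
      using W(1)[OF that] assms(1)[of i] by (auto simp: omega_covers_def)
    then have "W i \<noteq> topspace T" "W i \<subseteq> topspace T"
      by (auto simp: open_covers_def dest: openin_subset)
    then show ?thesis by blast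
  qed
  then obtain x where x: "\<And>i. i < m \<Longrightarrow> x i \<in> topspace T - W i" by metis
  have "finite (F \<union> x ` {..<m})" "F \<union> x ` {..<m} \<subseteq> topspace T" using assms(2,3) x by auto
  then obtain V where V: "V \<in> \<U> m" "F \<union> x ` {..<m} \<subseteq> V"
    using assms(1)[of m] unfolding omega_covers_def by blast
  have "V \<noteq> W i" if "i < m" for i using x[OF that] V(2) that by blast
  then have "V \<notin> W ` {..<m}" by blast
  then have "inj_on (W(m := V)) {..<Suc m}"
    using W(2) by (simp add: lessThan_Suc inj_on_fun_updI image_iff)
  moreover have "\<forall>i<Suc m. (W(m := V)) i \<in> \<U> i \<and> F \<subseteq> (W(m := V)) i"
    using W(1) V by (auto simp: less_Suc_eq)
  ultimately show ?case by blast
qed simp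

lemma strict_mono_block:
  fixes t :: "nat \<Rightarrow> nat"
  assumes "strict_mono t" "t 0 = 0"
  shows "\<exists>n. t n \<le> s \<and> s < t (Suc n)"
proof -
  have ex: "\<exists>n. s < t n" using strict_mono_imp_increasing[OF assms(1), of "Suc s"] Suc_le_eq by blast
  define n where "n = (LEAST n. s < t n)"
  have "s < t n" unfolding n_def using ex by (rule LeastI_ex)
  moreover from this obtain k where k: "n = Suc k" using assms(2) by (cases n) auto
  moreover have "\<not> s < t k" using not_less_Least[of k "\<lambda>n. s < t n"] k by (simp flip: n_def)
  ultimately show ?thesis by (intro exI[of _ k]) auto
qed

text \<open>A set of k points is the range of a point of the k-th power, which is covered by the
  k-th powers of the members of \<open>\<V> n\<close>. The values of k are served by different
  subsequences. Taking \<open>Pow V\<close> turns finite sets into points: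
  \<open>F \<in> Pow V\<close> iff \<open>F \<subseteq> V\<close>.\<close>

lemma selectable_finite_sets:
  assumes "\<And>n V. V \<in> \<V> n \<Longrightarrow> openin T V"
    and "\<And>n F. finite F \<Longrightarrow> F \<subseteq> topspace T \<Longrightarrow> \<exists>V\<in>\<V> n. F \<subseteq> V"
    and hr: "\<And>k. hr_space (finite_power T k)"
  shows "selectable (\<lambda>n. Pow ` \<V> n) {F. finite F \<and> F \<subseteq> topspace T}"
proof -
  let ?P = "\<lambda>k::nat. PiE {..<k} (\<lambda>_. topspace T)"
  have "selectable (\<lambda>n. Pow ` \<V> (prod_encode (k, n))) ((\<lambda>y. y ` {..<k}) ` ?P k)" for k
  proof (rule selectable_image)
    let ?C = "\<lambda>n. (\<lambda>V. PiE {..<k} (\<lambda>_. V)) ` \<V> (prod_encode (k, n))"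
    have "selectable ?C (topspace (finite_power T k))"
    proof (rule hr_spaceD[OF hr])
      show "?C n \<noteq> {}" for n using assms(2)[of "{}" "prod_encode (k, n)"] by auto
      show "openin (finite_power T k) U" if "U \<in> ?C n" for U n
        using that assms(1) by (auto simp: finite_power_def openin_PiE_gen)
      show "topspace (finite_power T k) \<subseteq> \<Union>(?C n)" for n
      proof
        fix y assume "y \<in> topspace (finite_power T k)"
        then have y: "y \<in> ?P k" by (simp add: finite_power_def)
        then obtain V where "V \<in> \<V> (prod_encode (k, n))" "y ` {..<k} \<subseteq> V"
          using assms(2)[of "y ` {..<k}" "prod_encode (k, n)"] by auto
        with y show "y \<in> \<Union>(?C n)" by (intro UnionI[of "PiE {..<k} (\<lambda>_. V)"]) (auto simp: PiE_iff)
      qed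
    qed
    then show "selectable ?C (?P k)" by (simp add: finite_power_def)
    show "\<exists>U\<in>Pow ` \<V> (prod_encode (k, n)). (\<lambda>y. y ` {..<k}) ` (C \<inter> ?P k) \<subseteq> U"
      if "C \<in> ?C n" for n C
      using that by (auto simp: PiE_iff)
  qed
  then have sel_Un: "selectable (\<lambda>n. Pow ` \<V> n) (\<Union>k. (\<lambda>y. y ` {..<k}) ` ?P k)" by (rule selectable_Union)
  have in_Un: "F \<in> (\<Union>k. (\<lambda>y. y ` {..<k}) ` ?P k)" if F: "finite F" "F \<subseteq> topspace T" for F
  proof -
    obtain h where "bij_betw h {..<card F} F"
      using F(1) by (metis bij_betw_from_nat_into_finite)
    then have "restrict h {..<card F} \<in> ?P (card F)" "F = restrict h {..<card F} ` {..<card F}"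
      using F(2) by (auto simp: bij_betw_def)
    then show ?thesis by blast
  qed
  show ?thesis by (rule selectable_subset[OF sel_Un]) (use in_Un in blast)
qed

lemma S1_groupable:
  assumes hr: "\<And>k. hr_space (finite_power T k)"
  shows "S1 (omega_covers T) (gp_omega_covers T)"
  unfolding S1_def
proof (intro allI impI)
  fix \<U> :: "nat \<Rightarrow> 'a set set"
  assume \<U>: "\<forall>n. \<U> n \<in> omega_covers T"
  then have op: "openin T V" if "V \<in> \<U> n" for n V
    using that by (auto simp: omega_covers_def open_covers_def)
  \<comment> \<open>Stage \<open>n\<close> owns the \<open>t n + 1\<close> indices of \<open>[t n, t (Suc n))\<close>. As only \<open>t n\<close> indices come before,
    one of any \<open>t n + 1\<close> distinct sets selected there has not been selected at an earlier stage.\<close>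
  define t :: "nat \<Rightarrow> nat" where "t n = 2 ^ n - 1" for n
  have t_Suc: "t (Suc n) = t n + Suc (t n)" for n
    using one_le_power[of "2::nat" n] unfolding t_def power_Suc by linarith
  have t: "strict_mono t" "t 0 = 0" by (auto simp: strict_mono_Suc_iff t_Suc) (simp add: t_def)
  define good where "good n W \<longleftrightarrow> (\<forall>i<Suc (t n). W i \<in> \<U> (t n + i)) \<and> inj_on W {..<Suc (t n)}"
    for n W
  \<comment> \<open>A finite set inside the intersection lies in every member of the group,
    whichever turns out to be new.\<close>
  define \<V> where "\<V> n = {\<Inter>(W ` {..<Suc (t n)}) | W. good n W}" for n
  have "selectable (\<lambda>n. Pow ` \<V> n) {F. finite F \<and> F \<subseteq> topspace T}"
  proof (rule selectable_finite_sets[OF _ _ hr])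
    show "openin T V" if "V \<in> \<V> n" for n V
      using that op by (auto simp: \<V>_def good_def intro!: openin_Inter)
    show "\<exists>V\<in>\<V> n. F \<subseteq> V" if F: "finite F" "F \<subseteq> topspace T" for n F
    proof -
      obtain W where "\<forall>i<Suc (t n). W i \<in> \<U> (t n + i) \<and> F \<subseteq> W i" "inj_on W {..<Suc (t n)}"
        using ex_distinct_omega_cover_members[of "\<lambda>i. \<U> (t n + i)" T F "Suc (t n)"] \<U> F by blast
      then show ?thesis by (intro bexI[of _ "\<Inter>(W ` {..<Suc (t n)})"]) (auto simp: \<V>_def good_def)
    qed
  qed
  then obtain P N where P: "\<And>n. P n \<in> Pow ` \<V> n"
    and N: "\<And>F. F \<in> {F. finite F \<and> F \<subseteq> topspace T} \<Longrightarrow>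
      \<forall>\<^sub>F j in sequentially. \<exists>n. j \<le> n \<and> n < N j \<and> F \<in> P n"
    by (rule selectableE) (rule that)
  have "\<forall>n. \<exists>W. good n W \<and> P n = Pow (\<Inter>(W ` {..<Suc (t n)}))"
  proof
    fix n
    obtain V where "V \<in> \<V> n" "P n = Pow V" using P[of n] by (rule imageE)
    then show "\<exists>W. good n W \<and> P n = Pow (\<Inter>(W ` {..<Suc (t n)}))"
      unfolding \<V>_def mem_Collect_eq by (elim exE conjE) (intro exI conjI, assumption, simp only:)
  qed
  from choice[OF this] obtain W
    where W_ex: "\<forall>n. good n (W n) \<and> P n = Pow (\<Inter>(W n ` {..<Suc (t n)}))" ..
  have W: "good n (W n)" "P n = Pow (\<Inter>(W n ` {..<Suc (t n)}))" for n
    using spec[OF W_ex, of n] by (rule conjunct1, rule conjunct2)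
  obtain st where st: "\<And>s. t (st s) \<le> s \<and> s < t (Suc (st s))"
    using strict_mono_block[OF t] by metis
  define U where "U s = W (st s) (s - t (st s))" for s
  have U_W: "U (t n + i) = W n i" if "i < Suc (t n)" for n i
  proof -
    have "t n \<le> t n + i" "t n + i < t (Suc n)" using that t_Suc by auto
    then have "st (t n + i) = n"
      using st[of "t n + i"] strict_mono_less[OF t(1)] by (metis le_less_trans less_Suc_eq_le order_antisym)
    then show ?thesis by (simp add: U_def)
  qed
  have U: "U s \<in> \<U> s" for s
  proof -
    have "s - t (st s) < Suc (t (st s))" using st[of s] t_Suc[of "st s"] by linarith
    then have "W (st s) (s - t (st s)) \<in> \<U> (t (st s) + (s - t (st s)))"
      using W(1)[of "st s"] unfolding good_def by blast
    then show ?thesis using st[of s] by (simp add: U_def)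
  qed

  \<comment> \<open>The window from \<open>m j\<close> to \<open>N (m j)\<close> now fits between
    \<open>m j\<close> and \<open>m (Suc j)\<close>; the maximum with \<open>Suc a\<close> makes
    \<open>m\<close> strictly increasing.\<close>
  define m where "m = rec_nat 0 (\<lambda>_ a. max (N a) (Suc a))"
  have m: "m 0 = 0" "\<And>j. m (Suc j) = max (N (m j)) (Suc (m j))" by (simp_all add: m_def)
  have m_mono: "strict_mono m" unfolding strict_mono_Suc_iff m(2) by auto
  have tm: "strict_mono (t \<circ> m)" "(t \<circ> m) 0 = 0"
    using strict_mono_o[OF t(1) m_mono] t(2) m(1) by auto
  \<comment> \<open>A set is put into the block of its first occurrence, so the blocks are disjoint
    even if \<open>U\<close> repeats values.\<close>
  define \<F> where "\<F> j = U ` {..<t (m (Suc j))} - U ` {..<t (m j)}" for j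
  have gp: "\<forall>\<^sub>F j in cofinite. \<exists>V\<in>\<F> j. F \<subseteq> V" if F: "finite F" "F \<subseteq> topspace T" for F
  proof -
    have "\<forall>\<^sub>F j in sequentially. \<exists>n. m j \<le> n \<and> n < N (m j) \<and> F \<in> P n"
      using N[of F] F by (intro eventually_compose_filterlim[OF _ filterlim_subseq[OF m_mono]]) simp
    then show ?thesis unfolding cofinite_eq_sequentially
    proof eventually_elim
      case (elim j)
      then obtain n where n: "m j \<le> n" "n < m (Suc j)" "F \<in> P n" by (auto simp: m(2))
      have "\<not> W n ` {..<Suc (t n)} \<subseteq> U ` {..<t n}"
      proof
        assume "W n ` {..<Suc (t n)} \<subseteq> U ` {..<t n}"
        then have "card (W n ` {..<Suc (t n)}) \<le> card (U ` {..<t n})" by (intro card_mono) auto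
        also have "\<dots> \<le> t n" using card_image_le[of "{..<t n}" U] by simp
        finally show False using W(1)[of n] by (simp add: good_def card_image)
      qed
      then obtain i where i: "i < Suc (t n)" "W n i \<notin> U ` {..<t n}" by blast
      have "t (Suc n) \<le> t (m (Suc j))" "t (m j) \<le> t n"
        using n strict_mono_less_eq[OF t(1)] by auto
      then have "t n + i < t (m (Suc j))" "{..<t (m j)} \<subseteq> {..<t n}" using i t_Suc[of n] by auto
      then have "W n i \<in> \<F> j" using i U_W[of i n] unfolding \<F>_def by (metis DiffI image_eqI image_mono lessThan_iff subsetD)
      moreover have "F \<subseteq> W n i" using n(3) i(1) by (auto simp: W(2))
      ultimately show ?case by blast
    qed
  qed
  have "\<F> i \<inter> \<F> j = {}" if "i < j" for i j
  proof -
    have "t (m (Suc i)) \<le> t (m j)" using that strict_mono_less_eq[OF tm(1), of "Suc i" j] by simp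
    then have "U ` {..<t (m (Suc i))} \<subseteq> U ` {..<t (m j)}" by (intro image_mono) auto
    then show ?thesis unfolding \<F>_def by blast
  qed
  then have disj: "disjoint_family \<F>"
    unfolding disjoint_family_on_def by (metis Int_commute linorder_neqE_nat)
  have un: "range U = (\<Union>n. \<F> n)"
  proof
    show "range U \<subseteq> (\<Union>n. \<F> n)"
    proof
      fix V assume "V \<in> range U"
      then have ex: "\<exists>s. U s = V" by blast
      define s where "s = (LEAST s. U s = V)"
      have s: "U s = V" unfolding s_def using ex by (rule LeastI_ex)
      have first: "U r \<noteq> V" if "r < s" for r
        using not_less_Least[of r "\<lambda>s. U s = V"] that by (simp add: s_def)
      obtain j where "t (m j) \<le> s" "s < t (m (Suc j))"
        using strict_mono_block[OF tm, of s] unfolding o_def by (elim exE conjE) (rule that)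
      then have "V \<in> U ` {..<t (m (Suc j))}" "\<And>r. r < t (m j) \<Longrightarrow> U r \<noteq> V"
        using s first order.strict_trans2 by blast+
      then have "V \<in> U ` {..<t (m (Suc j))}" "V \<notin> U ` {..<t (m j)}" by blast+
      then have "V \<in> \<F> j" by (simp add: \<F>_def)
      then show "V \<in> (\<Union>n. \<F> n)" by blast
    qed
  qed (auto simp: \<F>_def)
  have fin: "\<forall>n. finite (\<F> n)" by (simp add: \<F>_def)
  have om: "\<exists>V\<in>range U. F \<subseteq> V" if "finite F" "F \<subseteq> topspace T" for F
    using eventually_happens[OF gp[OF that, unfolded cofinite_eq_sequentially]] un by auto
  have "openin T (U s)" for s using op U by blast
  moreover have "topspace T \<subseteq> \<Union>(range U)"
  proof
    fix y assume "y \<in> topspace T"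
    then show "y \<in> \<Union>(range U)" using om[of "{y}"] by blast
  qed
  ultimately have "range U \<in> open_covers T"
    using openin_subset[of T] unfolding open_covers_def by blast
  moreover have "topspace T \<noteq> U s" for s
    using U[of s] \<U>[rule_format, of s] by (auto simp: omega_covers_def)
  ultimately have "range U \<in> omega_covers T" using om by (auto simp: omega_covers_def)
  then have "range U \<in> gp_omega_covers T"
    unfolding gp_omega_covers_def using disj un fin
    by (intro CollectI conjI exI[of _ \<F>] allI impI gp) auto
  then show "\<exists>U. (\<forall>n. U n \<in> \<U> n) \<and> range U \<in> gp_omega_covers T" using U by blast
qed

section \<open>Small sets below the bounding number and the covering number\<close>

lemma bounding_number_attained:
  obtains A where "\<not> bounded_star A" "\<bb> = |A|" "\<And>Y. \<not> bounded_star Y \<Longrightarrow> |A| \<le>o |Y|"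
  using min_card_attained[OF unbounded_exists] unfolding bounding_number_def by auto

lemma bounded_star_if_card_less:
  assumes "|Y| <o \<bb>"
  shows "bounded_star Y"
  using assms bounding_number_attained not_ordLess_ordLeq by metis

lemma bounded_star_countable:
  assumes "countable Y"
  shows "bounded_star Y"
proof -
  have "f \<le>\<^sup>* (\<lambda>n. \<Sum>i\<le>n. from_nat_into Y i n)" if "f \<in> Y" for f
    unfolding le_star_def cofinite_eq_sequentially
    using eventually_ge_at_top[of "to_nat_on Y f"]
  proof eventually_elim
    case (elim n)
    have "f n = from_nat_into Y (to_nat_on Y f) n" using assms that by simp
    also have "\<dots> \<le> (\<Sum>i\<le>n. from_nat_into Y i n)" using elim by (intro member_le_sum) auto
    finally show ?case .
  qed
  then show ?thesis unfolding bounded_star_def by blast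
qed

lemma card_less_bounding_if_countable:
  assumes "countable D"
  shows "|D| <o \<bb>"
proof -
  obtain A where A: "\<not> bounded_star A" "\<bb> = |A|" by (rule bounding_number_attained)
  have "\<not> |A| \<le>o |D|"
  proof
    assume "|A| \<le>o |D|"
    then obtain f where "inj_on f A" "f ` A \<subseteq> D" unfolding card_of_ordLeq[symmetric] by blast
    then have "countable A" using assms countable_subset countable_image_inj_on by blast
    then show False using A(1) bounded_star_countable[of A] by simp
  qed
  then show ?thesis unfolding A(2) by (simp add: not_ordLeq_iff_ordLess)
qed

lemma Card_order_bounding: "Card_order \<bb>"
  using bounding_number_attained card_of_Card_order by metis

lemma infinite_Field_bounding: "infinite (Field \<bb>)"
proof -
  obtain A where A: "\<not> bounded_star A" "\<bb> = |A|" by (rule bounding_number_attained)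
  have "infinite A" using A(1) bounded_star_countable countable_finite by blast
  then show ?thesis unfolding A(2) by (simp add: Field_card_of)
qed

lemma card_less_image: "|A| <o r \<Longrightarrow> |f ` A| <o r"
  by (rule ordLeq_ordLess_trans[OF card_of_image])

lemma card_less_bounding_Times: "|A| <o \<bb> \<Longrightarrow> |B| <o \<bb> \<Longrightarrow> |A \<times> B| <o \<bb>"
  by (rule card_of_Times_ordLess_infinite_Field[OF infinite_Field_bounding Card_order_bounding])

section \<open>Baire category and the covering number\<close>

lemma nowhere_denseI:
  fixes A :: "real set"
  assumes "\<And>y e. e > 0 \<Longrightarrow> \<exists>G. open G \<and> G \<noteq> {} \<and> G \<subseteq> ball y e \<and> G \<inter> A = {}"
  shows "nowhere_dense A"
proof -
  have "y \<notin> interior (closure A)" for y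
  proof
    assume "y \<in> interior (closure A)"
    then obtain e where e: "e > 0" "ball y e \<subseteq> closure A" unfolding mem_interior by blast
    then obtain G where G: "open G" "G \<noteq> {}" "G \<subseteq> ball y e" "G \<inter> A = {}" using assms[OF e(1), of y] by (elim exE conjE) (rule that)
    then show False using e(2) open_Int_closure_eq_empty[OF G(1), of A] by blast
  qed
  then show ?thesis unfolding nowhere_dense_def by blast
qed

text \<open>
  This map transfers the covering number from the real line to the Baire space: on each dyadic
  interval of level \<open>n\<close> the \<open>n\<close>-th value runs through all natural numbers.
\<close>

definition baire_digits :: "real \<Rightarrow> nat \<Rightarrow> nat"
  where "baire_digits x n = nat \<lfloor>1 / frac (2 ^ n * x) - 1\<rfloor>"

text \<open>Every ball contains a dyadic interval of some level n \<ge> k, and on an open piece of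
  it the n-th digit equals \<open>t n\<close>.\<close>

lemma nowhere_dense_baire_digits: "nowhere_dense {x. \<forall>n\<ge>k. baire_digits x n \<noteq> t n}"
proof (rule nowhere_denseI)
  fix y e :: real assume e: "e > 0"
  obtain n0 where n0: "2 / e < 2 ^ n0" using real_arch_pow[of 2 "2 / e"] by auto
  define n where "n = max n0 k"
  have "2 < 2 ^ n0 * e" using n0 e by (simp add: field_simps)
  also have "\<dots> \<le> 2 ^ n * e" using e by (intro mult_right_mono) (simp_all add: n_def)
  finally have n: "2 < 2 ^ n * e" "k \<le> n" by (simp_all add: n_def)
  define v where "v = real (t n)"
  \<comment> \<open>The dyadic interval of \<open>y\<close> at level n starts at
    \<open>i / 2 ^ n\<close>. Between \<open>a\<close> and \<open>b\<close> the fractional part of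
    \<open>2 ^ n * x\<close> lies between \<open>1 / (v + 2)\<close> and \<open>1 / (v + 1)\<close>,
    so the digit is the floor of a number between \<open>v\<close> and \<open>v + 1\<close>.\<close>
  define i where "i = of_int \<lfloor>2 ^ n * y\<rfloor> + (0::real)"
  define a where "a = (i + 1 / (v + 2)) / 2 ^ n"
  define b where "b = (i + 1 / (v + 1)) / 2 ^ n"
  have v: "v \<ge> 0" by (simp add: v_def)
  then have "1 / (v + 2) < 1 / (v + 1)" by (simp add: field_simps)
  then have "a < b" by (simp add: a_def b_def divide_strict_right_mono)
  have x: "x \<in> ball y e \<and> baire_digits x n = t n" if "x \<in> {a<..<b}" for x
  proof -
    have lo: "i + 1 / (v + 2) < 2 ^ n * x" and hi: "2 ^ n * x < i + 1 / (v + 1)"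
      using that by (simp_all add: a_def b_def field_simps)
    have bd: "0 < 1 / (v + 2)" "1 / (v + 1) \<le> 1" using v by (simp_all add: field_simps)
    have i: "i \<le> 2 ^ n * y" "2 ^ n * y < i + 1" unfolding i_def by linarith+
    have "\<bar>2 ^ n * y - 2 ^ n * x\<bar> < 2 ^ n * e" using lo hi bd i n(1) by linarith
    moreover have "\<bar>2 ^ n * y - 2 ^ n * x\<bar> = 2 ^ n * \<bar>y - x\<bar>"
      by (simp add: abs_mult flip: right_diff_distrib)
    ultimately have "x \<in> ball y e" by (simp add: dist_real_def)
    have "\<lfloor>2 ^ n * x\<rfloor> = \<lfloor>2 ^ n * y\<rfloor>" 
      using lo hi bd i_def unfolding floor_eq_iff by linarith
    then have f: "frac (2 ^ n * x) = 2 ^ n * x - i" by (simp add: frac_def i_def)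
    define w where "w = 2 ^ n * x - i"
    have w: "1 / (v + 2) < w" "w < 1 / (v + 1)" using lo hi by (simp_all add: w_def)
    then have w0: "w > 0" using bd(1) by linarith
    then have "v + 1 < 1 / w" "1 / w < v + 2" using w v by (simp_all add: field_simps)
    then have "\<lfloor>1 / w - 1\<rfloor> = int (t n)" unfolding floor_eq_iff v_def by simp
    then have "baire_digits x n = t n" by (simp add: baire_digits_def f flip: w_def)
    with \<open>x \<in> ball y e\<close> show ?thesis by blast
  qed
  show "\<exists>G. open G \<and> G \<noteq> {} \<and> G \<subseteq> ball y e \<and> G \<inter> {x. \<forall>n\<ge>k. baire_digits x n \<noteq> t n} = {}"
  proof (intro exI[of _ "{a<..<b}"] conjI)
    show "{a<..<b} \<noteq> {}" using \<open>a < b\<close> by simp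
    show "{a<..<b} \<inter> {x. \<forall>n\<ge>k. baire_digits x n \<noteq> t n} = {}" using x n(2) by blast
  qed (use x in auto)
qed

text \<open>The reals whose digits differ from \<open>s d\<close> from some place on form a meager
  set. Fewer than cov(M) such sets omit a real, and its digits serve as \<open>u\<close>.\<close>

lemma ex_infinitely_often_equal:
  fixes s :: "'d \<Rightarrow> nat \<Rightarrow> nat"
  assumes "|D| <o cov_meager"
  shows "\<exists>u. \<forall>d\<in>D. \<forall>k. \<exists>n\<ge>k. u n = s d n"
proof -
  define M where "M d = (\<Union>k. {x. \<forall>n\<ge>k. baire_digits x n \<noteq> s d n})" for d
  have mgr: "meager (M d)" for d
    unfolding meager_def M_def
    by (rule exI[of _ "range (\<lambda>k. {x. \<forall>n\<ge>k. baire_digits x n \<noteq> s d n})"])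
      (auto intro: nowhere_dense_baire_digits)
  have "\<Union>(M ` D) \<noteq> UNIV"
  proof
    assume "\<Union>(M ` D) = UNIV"
    then have "M ` D \<in> {\<C>. (\<forall>A\<in>\<C>. meager A) \<and> \<Union>\<C> = UNIV}" using mgr by auto
    then have "cov_meager \<le>o |M ` D|"
      using min_card_attained[OF meager_cover_exists] unfolding cov_meager_def by fastforce
    then show False using not_ordLess_ordLeq[OF card_less_image[OF assms, of M]] by contradiction
  qed
  then obtain x where "x \<notin> \<Union>(M ` D)" by blast
  then have "\<forall>d\<in>D. \<forall>k. \<exists>n\<ge>k. baire_digits x n = s d n" by (auto simp: M_def)
  then show ?thesis by blast
qed

text \<open>By the Lindelof property the covers may be thinned to countable ones and numbered. Each
  d then yields the function \<open>s d\<close> of numbers of members containing it, and these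
  functions are guessed infinitely often.\<close>

lemma ex_infinitely_often_selection:
  fixes D :: "'a::second_countable_topology set"
  assumes D: "|D| <o cov_meager" and ne: "\<And>n::nat. \<U> n \<noteq> {}"
    and op: "\<And>n U. U \<in> \<U> n \<Longrightarrow> openin (top_of_set Z) U" and cov: "\<And>n. D \<subseteq> \<Union>(\<U> n)"
  shows "\<exists>U. (\<forall>n. U n \<in> \<U> n) \<and> (\<forall>d\<in>D. \<forall>k. \<exists>n\<ge>k. d \<in> U n)"
proof -
  have "\<exists>V. V \<noteq> {} \<and> V \<subseteq> \<U> n \<and> countable V \<and> D \<subseteq> \<Union>V" for n
  proof -
    obtain V where V: "V \<subseteq> \<U> n" "countable V" "\<Union>V = \<Union>(\<U> n)"
      using Lindelof_openin[of "\<U> n" Z] op by blast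
    \<comment> \<open>\<open>W\<close> keeps the subfamily nonempty even for empty \<open>D\<close>,
      so \<open>from_nat_into\<close> always returns a member.\<close>
    obtain W where "W \<in> \<U> n" using ne[of n] by blast
    then show ?thesis using V cov[of n] by (intro exI[of _ "insert W V"]) auto
  qed
  then have "\<forall>n. \<exists>V. V \<noteq> {} \<and> V \<subseteq> \<U> n \<and> countable V \<and> D \<subseteq> \<Union>V" by (rule allI)
  from choice[OF this] obtain V
    where V: "\<forall>n. V n \<noteq> {} \<and> V n \<subseteq> \<U> n \<and> countable (V n) \<and> D \<subseteq> \<Union>(V n)" ..
  have "\<exists>i. d \<in> from_nat_into (V n) i" if "d \<in> D" for d n
  proof -
    obtain W where "W \<in> V n" "d \<in> W" using spec[OF V, of n] \<open>d \<in> D\<close> by blast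
    then show ?thesis using spec[OF V, of n] by (intro exI[of _ "to_nat_on (V n) W"]) simp
  qed
  then obtain s where s: "\<And>d n. d \<in> D \<Longrightarrow> d \<in> from_nat_into (V n) (s d n)" by metis
  obtain u where u: "\<forall>d\<in>D. \<forall>k. \<exists>n\<ge>k. u n = s d n"
    using ex_infinitely_often_equal[OF D] by blast
  define U where "U n = from_nat_into (V n) (u n)" for n
  have "U n \<in> \<U> n" for n using from_nat_into[of "V n" "u n"] spec[OF V, of n] by (auto simp: U_def)
  moreover have "\<exists>n\<ge>k. d \<in> U n" if d: "d \<in> D" for d k
  proof -
    obtain n where "n \<ge> k" "u n = s d n" using u d by blast
    then show ?thesis using s[OF d, of n] by (intro exI[of _ n]) (simp add: U_def)
  qed
  ultimately show ?thesis by blast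
qed

section \<open>The compact space of increasing extended sequences\<close>

lemma compact_UNIV_fun:
  assumes "compact (UNIV :: 'b::topological_space set)"
  shows "compact (UNIV :: ('a \<Rightarrow> 'b) set)"
proof -
  have "compact_space (euclidean :: 'b topology)" using assms by (simp add: compact_space_def)
  then have "compact_space (product_topology (\<lambda>_::'a. euclidean :: 'b topology) UNIV)"
    by (simp add: compact_space_product_topology)
  then show ?thesis by (simp add: euclidean_product_topology compact_space_def)
qed

text \<open>As \<infinity> + 1 = \<infinity>, one weak inequality captures both monotonicity and
  strictness at finite values, and it is visibly a closed condition.\<close>

lemma ext_incr_iff: "f \<in> ext_incr \<longleftrightarrow> (\<forall>n. f n + 1 \<le> f (Suc n))"
proof
  assume "f \<in> ext_incr"
  then have f: "mono f" "\<And>n. f n < \<infinity> \<Longrightarrow> f n < f (Suc n)" by (auto simp: ext_incr_def)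
  show "\<forall>n. f n + 1 \<le> f (Suc n)"
  proof
    fix n
    show "f n + 1 \<le> f (Suc n)"
    proof (cases "f n < \<infinity>")
      case True
      then show ?thesis using f(2) ileI1 by (metis plus_1_eSuc(2))
    next
      case False
      then show ?thesis using monoD[OF f(1), of n "Suc n"] by simp
    qed
  qed
next
  assume f: "\<forall>n. f n + 1 \<le> f (Suc n)"
  then have "f n \<le> f (Suc n)" for n by (meson le_iff_add order_trans)
  then have "mono f" by (simp add: mono_iff_le_Suc)
  moreover have "f n < f (Suc n)" if "f n < \<infinity>" for n
    using f[rule_format, of n] that by (cases "f n") (auto simp: one_enat_def Suc_ile_eq)
  ultimately show "f \<in> ext_incr" by (simp add: ext_incr_def)
qed

lemma closed_ext_incr: "closed ext_incr"
proof -
  have "ext_incr = {f. \<forall>n. f n + 1 \<le> f (Suc n)}" using ext_incr_iff by blast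
  also have "closed \<dots>"
    by (intro closed_Collect_all closed_Collect_le continuous_intros continuous_on_product_coordinates)
  finally show ?thesis .
qed

lemma to_ext_in_ext_incr: "strict_mono f \<Longrightarrow> to_ext f \<in> ext_incr"
  by (auto simp: to_ext_def ext_incr_def strict_mono_Suc_iff mono_iff_le_Suc less_imp_le)

lemma Q_inf_subset_ext_incr: "Q_inf \<subseteq> ext_incr"
  by (auto simp: Q_inf_def)

lemma countable_Q_inf: "countable Q_inf"
proof -
  have "Q_inf \<subseteq> range (\<lambda>xs n. if n < length xs then xs ! n else \<infinity>)"
  proof
    fix q assume "q \<in> Q_inf"
    then obtain m where "mono q" "q m = \<infinity>" by (auto simp: Q_inf_def ext_incr_def)
    then have "q n = \<infinity>" if "n \<ge> m" for n using monoD[OF \<open>mono q\<close> that] by simp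
    then have "q = (\<lambda>n. if n < length (map q [0..<m]) then map q [0..<m] ! n else \<infinity>)" by auto
    then show "q \<in> range (\<lambda>xs n. if n < length xs then xs ! n else \<infinity>)" by blast
  qed
  then show ?thesis by (rule countable_subset) simp
qed

text \<open>If no \<open>p\<close> worked, the closed sets \<open>C p\<close> would decrease without
  being empty. A common point is \<infinity> at \<open>j\<close> in each coordinate from
  \<open>I\<close>, so these coordinates lie in \<open>Q_inf\<close> and some \<open>V n\<close>
  with n \<ge> j contains the point, contradicting \<open>C (Suc n)\<close>. One number serves as
  threshold and as window end, so only one function per \<open>d\<close> has to be bounded
  later.\<close>

lemma ex_uniform_cover_near_Q_inf:
  fixes d :: "nat \<Rightarrow> nat \<Rightarrow> enat"
  assumes op: "\<And>n::nat. open (V n)"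
    and cov: "\<And>x. (\<forall>i\<in>I. x i \<in> Q_inf) \<Longrightarrow> (\<forall>i. i \<notin> I \<longrightarrow> x i = d i) \<Longrightarrow> \<exists>n\<ge>j. x \<in> V n"
  shows "\<exists>p. \<forall>x. (\<forall>i\<in>I. x i \<in> ext_incr \<and> enat p < x i j) \<and> (\<forall>i. i \<notin> I \<longrightarrow> x i = d i) \<longrightarrow>
    (\<exists>n. j \<le> n \<and> n < p \<and> x \<in> V n)"
proof (rule ccontr)
  assume contr: "\<not> ?thesis"
  define C where "C p = {x. (\<forall>i. i \<in> I \<longrightarrow> x i \<in> ext_incr \<and> enat p \<le> x i j) \<and>
    (\<forall>i. i \<notin> I \<longrightarrow> x i = d i)} - (\<Union>n\<in>{j..<p}. V n)" for p
  have "closed (C p)" for p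
  proof -
    have "closed {x :: nat \<Rightarrow> nat \<Rightarrow> enat. x i \<in> ext_incr}" for i
      using closed_vimage[OF closed_ext_incr continuous_on_product_coordinates[of i]]
      by (simp add: vimage_def)
    moreover have "closed {x :: nat \<Rightarrow> nat \<Rightarrow> enat. enat p \<le> x i j}" for i
      by (rule closed_Collect_le[OF continuous_on_const
            continuous_on_product_then_coordinatewise[OF continuous_on_product_coordinates]])
    moreover have "closed {x :: nat \<Rightarrow> nat \<Rightarrow> enat. x i = d i}" for i
      unfolding fun_eq_iff
      by (rule closed_Collect_all, rule closed_Collect_eq[OF
            continuous_on_product_then_coordinatewise[OF continuous_on_product_coordinates]
            continuous_on_const])
    ultimately have "closed {x :: nat \<Rightarrow> nat \<Rightarrow> enat. (\<forall>i. i \<in> I \<longrightarrow> x i \<in> ext_incr \<and> enat p \<le> x i j) \<and>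
        (\<forall>i. i \<notin> I \<longrightarrow> x i = d i)}"
      by (intro closed_Collect_conj closed_Collect_all closed_Collect_imp open_Collect_const) simp_all
    then show ?thesis unfolding C_def using op by (intro closed_Diff open_UN) auto
  qed
  moreover have "C p \<noteq> {}" for p
  proof -
    obtain x where "\<forall>i\<in>I. x i \<in> ext_incr \<and> enat p < x i j" "\<forall>i. i \<notin> I \<longrightarrow> x i = d i"
      "\<not> (\<exists>n. j \<le> n \<and> n < p \<and> x \<in> V n)"
      using spec[OF contr[unfolded not_ex], of p] unfolding not_all not_imp
      by (elim exE conjE) (rule that)
    then have "x \<in> C p" by (auto simp: C_def less_imp_le)
    then show ?thesis by blast
  qed
  moreover have "decseq C"
  proof (rule decseq_SucI)
    show "C (Suc p) \<subseteq> C p" for p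
    proof
      fix x assume x: "x \<in> C (Suc p)"
      have "enat p \<le> x i j" if "i \<in> I" for i
      proof -
        have "enat p \<le> enat (Suc p)" by simp
        also have "\<dots> \<le> x i j" using x that by (simp add: C_def)
        finally show ?thesis .
      qed
      then show "x \<in> C p" using x by (auto simp: C_def)
    qed
  qed
  moreover have "compact_space (euclidean :: (nat \<Rightarrow> nat \<Rightarrow> enat) topology)"
    using compact_UNIV_fun[OF compact_UNIV_fun[where 'b=enat]]
    by (simp add: compact_space_def compact_eq_closed)
  ultimately have "(\<Inter>p. C p) \<noteq> {}" by (intro compact_space_imp_nest) auto
  then obtain x where x: "\<And>p. x \<in> C p" by blast
  have "x i \<in> Q_inf" if "i \<in> I" for i
  proof -
    have "enat p \<le> x i j" for p using x[of p] that by (simp add: C_def)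
    then have "x i j = \<infinity>" by (metis Suc_ile_eq enat.exhaust order_less_irrefl)
    moreover have "x i \<in> ext_incr" using x[of 0] that by (simp add: C_def)
    ultimately show ?thesis by (auto simp: Q_inf_def)
  qed
  moreover have "\<forall>i. i \<notin> I \<longrightarrow> x i = d i" using x[of 0] by (simp add: C_def)
  ultimately obtain n where "n \<ge> j" "x \<in> V n" using cov by blast
  then show False using x[of "Suc n"] by (auto simp: C_def)
qed

text \<open>Frozen coordinates are stored in \<open>d\<close>, so a smaller \<open>I\<close> stays
  in the same ambient product.\<close>

definition mixed :: "'p set \<Rightarrow> ('i \<Rightarrow> 'p) set \<Rightarrow> 'i set \<Rightarrow> ('i \<Rightarrow> 'p) set"
  where "mixed Y D I = {x. \<exists>d\<in>D. (\<forall>i\<in>I. x i \<in> Y) \<and> (\<forall>i. i \<notin> I \<longrightarrow> x i = d i)}"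

lemma card_mixed_less_bounding:
  assumes "countable Y" "finite I" "|D| <o \<bb>"
  shows "|mixed Y D I| <o \<bb>"
proof -
  have "mixed Y D I \<subseteq> (\<lambda>(d, q) i. if i \<in> I then q i else d i) ` (D \<times> PiE I (\<lambda>_. Y))"
  proof
    fix x assume "x \<in> mixed Y D I"
    then obtain d where d: "d \<in> D" "\<forall>i\<in>I. x i \<in> Y" "\<forall>i. i \<notin> I \<longrightarrow> x i = d i"
      unfolding mixed_def by blast
    then have "x = (\<lambda>(d, q) i. if i \<in> I then q i else d i) (d, restrict x I)"
      by (auto simp: fun_eq_iff)
    then show "x \<in> (\<lambda>(d, q) i. if i \<in> I then q i else d i) ` (D \<times> PiE I (\<lambda>_. Y))"
      by (rule image_eqI) (use d in auto)
  qed
  moreover have "|D \<times> PiE I (\<lambda>_. Y)| <o \<bb>"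
    by (intro card_less_bounding_Times[OF assms(3)] card_less_bounding_if_countable countable_PiE assms)
  ultimately show ?thesis
    by (rule ordLeq_ordLess_trans[OF card_of_mono1 card_less_image])
qed

lemma card_underS_bounding: "\<alpha> \<in> Field \<bb> \<Longrightarrow> |underS \<bb> \<alpha>| <o \<bb>"
  by (rule card_of_underS[OF Card_order_bounding])

lemma bounding_not_underS:
  assumes "\<alpha> \<in> Field \<bb>" "\<beta> \<in> Field \<bb>" "\<beta> \<notin> underS \<bb> \<alpha>"
  shows "\<beta> = \<alpha> \<or> ((\<alpha>, \<beta>) \<in> \<bb> \<and> \<alpha> \<noteq> \<beta>)"
proof -
  have "wo_rel \<bb>"
    using Card_order_bounding unfolding wo_rel_def card_order_on_def by simp
  then show ?thesis using wo_rel.TOTALS[of "\<bb>"] assms unfolding underS_def by blast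
qed

section \<open>Finite powers of a scale\<close>

lemma ex_exceeding_if_not_le_star:
  assumes "\<not> h \<le>\<^sup>* g"
  shows "\<exists>a\<ge>j. g a < h a"
proof -
  have "infinite {a. \<not> h a \<le> g a}" using assms by (simp add: le_star_def eventually_cofinite)
  then obtain a where "a \<ge> j" "a \<in> {a. \<not> h a \<le> g a}" using infinite_nat_iff_unbounded_le by blast
  then show ?thesis by (auto simp: not_le)
qed

lemma eventually_Q_inf:
  assumes "q \<in> Q_inf"
  shows "\<forall>\<^sub>F a in sequentially. q a = \<infinity>"
proof -
  obtain m where m: "mono q" "q m = \<infinity>" using assms by (auto simp: Q_inf_def ext_incr_def)
  show ?thesis using eventually_ge_at_top[of m]
  proof eventually_elim
    case (elim a)
    then show ?case using monoD[OF m(1) elim] m(2) by simp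
  qed
qed

text \<open>Freezing a coordinate shrinks \<open>I\<close> but changes the base, so \<open>D\<close>
  is arbitrary in the induction. Empty \<open>I\<close> is included and gives the claim for
  \<open>D\<close> itself.\<close>

lemma hr_space_mixed:
  fixes S :: "(nat \<Rightarrow> nat) set"
  assumes bcov: "\<bb> \<le>o cov_meager" and S: "b_scale S" and Y: "Y = to_ext ` S \<union> Q_inf"
    and "finite I" and "|D| <o \<bb>"
  shows "hr_space (top_of_set (mixed Y D I :: (nat \<Rightarrow> nat \<Rightarrow> enat) set))"
  using \<open>finite I\<close> \<open>|D| <o \<bb>\<close>
proof (induction I arbitrary: D rule: finite_psubset_induct)
  case (psubset I)
  have S_unb: "\<not> bounded_star S" using S by (simp add: b_scale_def)
  obtain f where F: "S = f ` Field \<bb> \<and> (\<forall>\<alpha>\<in>Field \<bb>. strict_mono (f \<alpha>)) \<and>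
      (\<forall>\<alpha> \<beta>. (\<alpha>, \<beta>) \<in> \<bb> \<and> \<alpha> \<noteq> \<beta> \<longrightarrow> f \<alpha> \<le>\<^sup>* f \<beta>)"
    using conjunct2[OF S[unfolded b_scale_def]] ..
  have f: "S = f ` Field \<bb>" "\<And>\<alpha>. \<alpha> \<in> Field \<bb> \<Longrightarrow> strict_mono (f \<alpha>)"
    "\<And>\<alpha> \<beta>. (\<alpha>, \<beta>) \<in> \<bb> \<Longrightarrow> \<alpha> \<noteq> \<beta> \<Longrightarrow> f \<alpha> \<le>\<^sup>* f \<beta>"
    using F by simp_all
  have Y_ext: "Y \<subseteq> ext_incr"
    using f(1,2) to_ext_in_ext_incr Q_inf_subset_ext_incr by (auto simp: Y)
  let ?Z = "mixed Y D I"
  show ?case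
    unfolding hr_space_def
  proof (intro allI impI)
    fix \<U> :: "nat \<Rightarrow> (nat \<Rightarrow> nat \<Rightarrow> enat) set set"
    assume "\<forall>n. \<U> n \<noteq> {} \<and> (\<forall>U\<in>\<U> n. openin (top_of_set ?Z) U) \<and> topspace (top_of_set ?Z) \<subseteq> \<Union>(\<U> n)"
    then have \<U>: "\<And>n. \<U> n \<noteq> {}" "\<And>n U. U \<in> \<U> n \<Longrightarrow> openin (top_of_set ?Z) U" "\<And>n. ?Z \<subseteq> \<Union>(\<U> n)"
      by simp_all
    \<comment> \<open>Here \<bb> \<le> cov(M) enters: \<open>Q_inf\<close> is countable and
      \<open>I\<close> finite, so these tuples number fewer than \<bb>.\<close>
    have Q_small: "|mixed Q_inf D I| <o cov_meager"
      using card_mixed_less_bounding[OF countable_Q_inf psubset.hyps psubset.prems] bcov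
      by (rule ordLess_ordLeq_trans)
    have Q_sub: "mixed Q_inf D I \<subseteq> ?Z" unfolding mixed_def Y by blast
    have "\<exists>U. (\<forall>n. U n \<in> \<U> (prod_encode (0, n))) \<and>
        (\<forall>x\<in>mixed Q_inf D I. \<forall>k. \<exists>n\<ge>k. x \<in> U n)"
      using \<U>(1,2) order_trans[OF Q_sub \<U>(3)] by (rule ex_infinitely_often_selection[OF Q_small])
    then obtain U where U: "\<And>n. U n \<in> \<U> (prod_encode (0, n))"
      and U_inf: "\<And>x k. x \<in> mixed Q_inf D I \<Longrightarrow> \<exists>n\<ge>k. x \<in> U n" by blast
    have "\<forall>n. \<exists>V. open V \<and> U n = ?Z \<inter> V" using \<U>(2)[OF U] by (simp add: openin_open)
    from choice[OF this] obtain V where V: "\<forall>n. open (V n) \<and> U n = ?Z \<inter> V n" ..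
    have "\<exists>p. \<forall>x. (\<forall>i\<in>I. x i \<in> ext_incr \<and> enat p < x i j) \<and> (\<forall>i. i \<notin> I \<longrightarrow> x i = d i) \<longrightarrow>
        (\<exists>n. j \<le> n \<and> n < p \<and> x \<in> V n)" if d: "d \<in> D" for d j
    proof (rule ex_uniform_cover_near_Q_inf)
      fix x assume "\<forall>i\<in>I. x i \<in> Q_inf" "\<forall>i. i \<notin> I \<longrightarrow> x i = d i"
      then have "x \<in> mixed Q_inf D I" using d unfolding mixed_def by blast
      then obtain n where "n \<ge> j" "x \<in> U n" using U_inf by blast
      then show "\<exists>n\<ge>j. x \<in> V n" using V by auto
    qed (use V in simp)
    then have "\<forall>d j. \<exists>p. d \<in> D \<longrightarrow> (\<forall>x. (\<forall>i\<in>I. x i \<in> ext_incr \<and> enat p < x i j) \<and>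
        (\<forall>i. i \<notin> I \<longrightarrow> x i = d i) \<longrightarrow> (\<exists>n. j \<le> n \<and> n < p \<and> x \<in> V n))"
      by simp
    then obtain p where p_ex: "\<forall>d j. d \<in> D \<longrightarrow>
        (\<forall>x. (\<forall>i\<in>I. x i \<in> ext_incr \<and> enat (p d j) < x i j) \<and>
        (\<forall>i. i \<notin> I \<longrightarrow> x i = d i) \<longrightarrow> (\<exists>n. j \<le> n \<and> n < p d j \<and> x \<in> V n))"
      unfolding choice_iff by (elim exE) (rule that)
    have p: "\<exists>n. j \<le> n \<and> n < p d j \<and> x \<in> V n"
      if "d \<in> D" "\<And>i. i \<in> I \<Longrightarrow> x i \<in> ext_incr \<and> enat (p d j) < x i j"
        "\<And>i. i \<notin> I \<Longrightarrow> x i = d i" for d j x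
      using p_ex that by simp
    \<comment> \<open>The functions \<open>p d\<close> form a family of size below \<bb>, hence a
      bounded one.\<close>
    obtain g where g: "\<And>d. d \<in> D \<Longrightarrow> p d \<le>\<^sup>* g"
      using bounded_star_if_card_less[OF card_less_image[OF psubset.prems], of p]
      unfolding bounded_star_def by auto
    obtain \<alpha> where \<alpha>: "\<alpha> \<in> Field \<bb>" "\<not> f \<alpha> \<le>\<^sup>* g"
      using S_unb unfolding bounded_star_def f(1) by blast
    \<comment> \<open>\<open>f \<alpha>\<close> is only known to exceed \<open>g\<close> infinitely
      often, so \<open>nx j\<close> moves to such a place beyond \<open>j\<close>. The window there,
      ending at \<open>g (nx j)\<close>, also serves \<open>j\<close>.\<close>
    obtain nx where nx: "\<And>j. j \<le> nx j" "\<And>j. g (nx j) < f \<alpha> (nx j)"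
      using ex_exceeding_if_not_le_star[OF \<alpha>(2)] by metis
    define R where "R = {x. \<exists>d\<in>D. (\<forall>i\<in>I. x i \<in> Q_inf \<union> to_ext ` f ` (Field \<bb> - underS \<bb> \<alpha>)) \<and>
      (\<forall>i. i \<notin> I \<longrightarrow> x i = d i)}"
    have "selectable (\<lambda>n. \<U> (prod_encode (0, n))) R"
      unfolding selectable_def
    proof (intro exI[of _ U] exI[of _ "\<lambda>j. g (nx j)"] conjI ballI allI U)
      fix x assume "x \<in> R"
      then obtain d where d: "d \<in> D" "\<And>i. i \<in> I \<Longrightarrow> x i \<in> Q_inf \<union> to_ext ` f ` (Field \<bb> - underS \<bb> \<alpha>)"
        "\<And>i. i \<notin> I \<Longrightarrow> x i = d i" unfolding R_def by blast
      have x_Y: "x i \<in> Y" if "i \<in> I" for i using d(2)[OF that] f(1) Y by blast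
      then have x_Z: "x \<in> ?Z" using d(1,3) unfolding mixed_def by blast
      \<comment> \<open>Entries in \<open>Q_inf\<close> are eventually \<infinity>, and
        \<open>f \<beta>\<close> with \<beta> not below \<alpha> eventually dominates
        \<open>f \<alpha>\<close>. Since \<open>I\<close> is finite, one starting place works for
        all entries.\<close>
      have "\<forall>\<^sub>F a in sequentially. g a < f \<alpha> a \<longrightarrow> enat (g a) < x i a" if "i \<in> I" for i
      proof -
        consider "x i \<in> Q_inf" | \<beta> where "\<beta> \<in> Field \<bb>" "\<beta> \<notin> underS \<bb> \<alpha>" "x i = to_ext (f \<beta>)"
          using d(2)[OF \<open>i \<in> I\<close>] by blast
        then show ?thesis
        proof cases
          case 1
          then show ?thesis by (rule eventually_mono[OF eventually_Q_inf]) simp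
        next
          case (2 \<beta>)
          have "f \<alpha> \<le>\<^sup>* f \<beta>"
            using bounding_not_underS[OF \<alpha>(1) 2(1,2)] f(3) by (auto simp: le_star_def)
          then have "\<forall>\<^sub>F a in sequentially. f \<alpha> a \<le> f \<beta> a"
            by (simp add: le_star_def cofinite_eq_sequentially)
          then show ?thesis by (rule eventually_mono) (simp add: 2(3) to_ext_def)
        qed
      qed
      then have ev: "\<forall>\<^sub>F a in sequentially. \<forall>i\<in>I. g a < f \<alpha> a \<longrightarrow> enat (g a) < x i a"
        using psubset.hyps by (intro eventually_ball_finite) blast+
      have "\<forall>\<^sub>F a in sequentially. p d a \<le> g a"
        using g[OF d(1)] by (simp add: le_star_def cofinite_eq_sequentially)
      with ev have "\<forall>\<^sub>F a in sequentially. g a < f \<alpha> a \<longrightarrow> (\<exists>n. a \<le> n \<and> n < g a \<and> x \<in> U n)"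
      proof eventually_elim
        case (elim a)
        show ?case
        proof
          assume a: "g a < f \<alpha> a"
          have "x i \<in> ext_incr \<and> enat (p d a) < x i a" if "i \<in> I" for i
          proof -
            have "enat (p d a) \<le> enat (g a)" using elim(2) by simp
            also have "\<dots> < x i a" using elim(1) a that by blast
            finally show ?thesis using x_Y[OF that] Y_ext by blast
          qed
          from p[OF d(1) this d(3)] obtain n where "a \<le> n" "n < p d a" "x \<in> V n" by auto
          then show "\<exists>n. a \<le> n \<and> n < g a \<and> x \<in> U n"
            using V x_Z elim(2) by (intro exI[of _ n]) auto
        qed
      qed
      then obtain a0 where a0: "\<And>a. a \<ge> a0 \<Longrightarrow> g a < f \<alpha> a \<Longrightarrow> \<exists>n. a \<le> n \<and> n < g a \<and> x \<in> U n"
        unfolding eventually_sequentially by blast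
      show "\<forall>\<^sub>F j in sequentially. \<exists>n. j \<le> n \<and> n < g (nx j) \<and> x \<in> U n"
        using eventually_ge_at_top[of a0]
      proof eventually_elim
        case (elim j)
        then obtain n where "nx j \<le> n" "n < g (nx j)" "x \<in> U n"
          using a0[OF order_trans[OF elim nx(1)] nx(2)] by blast
        then show ?case using nx(1)[of j] by (intro exI[of _ n]) auto
      qed
    qed
    \<comment> \<open>Coordinate i is frozen at some \<open>f \<beta>\<close> with \<beta> below
      \<alpha>. Proper initial segments of \<bb> are smaller than \<bb>, so \<open>D' i\<close>
      remains small enough for the induction hypothesis.\<close>
    moreover define D' where "D' i = (\<lambda>(d, \<beta>). d(i := to_ext (f \<beta>))) ` (D \<times> underS \<bb> \<alpha>)" for i :: nat
    define R' where "R' i = (if i \<in> I then mixed Y (D' i) (I - {i}) else {})" for i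
    have R'_sub: "R' i \<subseteq> ?Z" for i
    proof
      fix x assume "x \<in> R' i"
      then have i: "i \<in> I" and "x \<in> mixed Y (D' i) (I - {i})"
        by (simp_all add: R'_def split: if_splits)
      then obtain d' where d': "d' \<in> D' i" "\<forall>k\<in>I - {i}. x k \<in> Y" "\<forall>k. k \<notin> I - {i} \<longrightarrow> x k = d' k"
        unfolding mixed_def by blast
      from d'(1) obtain d \<beta> where d: "d \<in> D" "\<beta> \<in> underS \<bb> \<alpha>" "d' = d(i := to_ext (f \<beta>))"
        unfolding D'_def by (auto elim!: imageE)
      have "\<beta> \<in> Field \<bb>" using d(2) by (auto simp: underS_def Field_def)
      then have "x i \<in> Y" using d'(3) d(3) f(1) Y by auto
      then show "x \<in> ?Z" unfolding mixed_def using d d' i by (auto intro!: bexI[of _ d])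
    qed
    have "selectable (\<lambda>n. \<U> (prod_encode (Suc i, n))) (R' i)" for i
    proof (cases "i \<in> I")
      case True
      have "|D' i| <o \<bb>"
        unfolding D'_def
        by (intro card_less_image card_less_bounding_Times psubset.prems card_underS_bounding \<alpha>(1))
      then have hr: "hr_space (top_of_set (R' i))"
        using psubset.IH[of "I - {i}" "D' i"] True by (auto simp: R'_def)
      have "selectable (\<lambda>n. \<U> (prod_encode (Suc i, n))) (id ` topspace (top_of_set (R' i)))"
      proof (rule hr_space_continuous_image[OF hr])
        show "continuous_map (top_of_set (R' i)) (top_of_set ?Z) id"
          using R'_sub[of i] by (auto simp: continuous_map_in_subtopology continuous_map_from_subtopology)
        show "id ` topspace (top_of_set (R' i)) \<subseteq> \<Union>(\<U> (prod_encode (Suc i, n)))" for n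
          using R'_sub[of i] \<U>(3)[of "prod_encode (Suc i, n)"] by auto
      qed (use \<U> in auto)
      then show ?thesis by simp
    next
      case False
      have "\<forall>n. \<exists>U. U \<in> \<U> (prod_encode (Suc i, n))" using \<U>(1) by blast
      from choice[OF this] show ?thesis using False by (auto simp: selectable_def R'_def)
    qed
    ultimately have "selectable \<U> (R \<union> (\<Union>i. R' i))" by (rule selectable_Un)
    moreover have "?Z \<subseteq> R \<union> (\<Union>i. R' i)"
    proof
      fix x assume "x \<in> ?Z"
      then obtain d where d: "d \<in> D" "\<forall>i\<in>I. x i \<in> Y" "\<forall>i. i \<notin> I \<longrightarrow> x i = d i"
        unfolding mixed_def by blast
      show "x \<in> R \<union> (\<Union>i. R' i)"
      proof (cases "\<exists>i\<in>I. \<exists>\<beta>\<in>underS \<bb> \<alpha>. x i = to_ext (f \<beta>)")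
        case True
        then obtain i \<beta> where i: "i \<in> I" "\<beta> \<in> underS \<bb> \<alpha>" "x i = to_ext (f \<beta>)" by blast
        have "d(i := to_ext (f \<beta>)) \<in> D' i" 
          unfolding D'_def by (rule image_eqI[of _ _ "(d, \<beta>)"]) (simp_all add: d(1) i(2))
        then have "x \<in> mixed Y (D' i) (I - {i})"
          unfolding mixed_def using d(2,3) i by (auto intro!: bexI[of _ "d(i := to_ext (f \<beta>))"])
        then show ?thesis using i(1) by (auto simp: R'_def)
      next
        case False
        have "x i \<in> Q_inf \<union> to_ext ` f ` (Field \<bb> - underS \<bb> \<alpha>)" if "i \<in> I" for i
        proof -
          consider "x i \<in> Q_inf" | \<beta> where "\<beta> \<in> Field \<bb>" "x i = to_ext (f \<beta>)"
            using d(2) \<open>i \<in> I\<close> f(1) Y by blast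
          then show ?thesis using False \<open>i \<in> I\<close> by cases auto
        qed
        then have "x \<in> R" unfolding R_def using d(1,3) by blast
        then show ?thesis by blast
      qed
    qed
    ultimately show "selectable \<U> (topspace (top_of_set ?Z))"
      using selectable_subset by simp
  qed
qed

section \<open>The generated field\<close>

text \<open>All finite powers of \<open>A\<close> in one space, padded by \<open>c\<close>, so that
  terms in any number of variables have a common domain.\<close>

definition fin_seq :: "'p set \<Rightarrow> 'p \<Rightarrow> (nat \<Rightarrow> 'p) set"
  where "fin_seq A c = {x. (\<forall>i. x i \<in> A) \<and> (\<exists>m. \<forall>i\<ge>m. x i = c)}"

text \<open>The k sequences become rows under the pairing function. Only finitely many entries
  precede the padding of their rows, so the merged sequence also ends in \<open>c\<close>.\<close>

lemma fin_seq_merge: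
  assumes "c \<in> A" "\<And>i. i < k \<Longrightarrow> y i \<in> fin_seq A c"
  shows "\<exists>z\<in>fin_seq A c. \<forall>i<k. \<forall>n. z (prod_encode (i, n)) = y i n"
proof -
  have "\<forall>i. \<exists>m. i < k \<longrightarrow> (\<forall>n\<ge>m. y i n = c)" using assms(2) by (auto simp: fin_seq_def)
  from choice[OF this] obtain m where m: "\<forall>i. i < k \<longrightarrow> (\<forall>n\<ge>m i. y i n = c)" ..
  define z where "z j = (case prod_decode j of (i, n) \<Rightarrow> if i < k then y i n else c)" for j
  have "finite (\<Union>i<k. (\<lambda>n. prod_encode (i, n)) ` {..<m i})" by simp
  then obtain M where M: "\<forall>j \<in> (\<Union>i<k. (\<lambda>n. prod_encode (i, n)) ` {..<m i}). j < M"
    unfolding finite_nat_set_iff_bounded ..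
  have "z j = c" if j: "j \<ge> M" for j
  proof -
    obtain i n where d: "prod_decode j = (i, n)" by (cases "prod_decode j")
    then have j': "j = prod_encode (i, n)" using prod_decode_inverse[of j] by simp
    have "n \<ge> m i" if "i < k"
    proof (rule ccontr)
      assume "\<not> n \<ge> m i"
      then have "j \<in> (\<Union>i<k. (\<lambda>n. prod_encode (i, n)) ` {..<m i})" using that j'
        by (intro UN_I[of i] image_eqI[of _ _ n]) auto
      then have "j < M" using M by (rule bspec[rotated])
      then show False using j by simp
    qed
    then show ?thesis using m by (auto simp: z_def d)
  qed
  moreover have "z j \<in> A" for j
    using assms by (auto simp: z_def fin_seq_def split: prod.split)
  ultimately have "z \<in> fin_seq A c" by (auto simp: fin_seq_def)
  then show ?thesis by (intro bexI[of _ z]) (simp_all add: z_def)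
qed

lemma fin_seq_image: "c \<in> A \<Longrightarrow> fin_seq (e ` A) (e c) = (\<lambda>x. e \<circ> x) ` fin_seq A c"
proof (intro equalityI subsetI)
  fix w assume c: "c \<in> A" and w: "w \<in> fin_seq (e ` A) (e c)"
  \<comment> \<open>An arbitrary preimage of \<open>e c\<close> could differ from \<open>c\<close>;
    choosing \<open>c\<close> keeps \<open>x\<close> eventually equal to \<open>c\<close>.\<close>
  define x where "x i = (if w i = e c then c else inv_into A e (w i))" for i
  have "w i = e (x i)" "x i \<in> A" for i
    using w c by (auto simp: x_def fin_seq_def f_inv_into_f inv_into_into)
  moreover have "\<exists>m. \<forall>i\<ge>m. x i = c" using w by (auto simp: fin_seq_def x_def)
  ultimately show "w \<in> (\<lambda>x. e \<circ> x) ` fin_seq A c"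
    by (intro image_eqI[of _ _ x]) (auto simp: fin_seq_def)
next
  fix w assume "w \<in> (\<lambda>x. e \<circ> x) ` fin_seq A c"
  then obtain x m where "w = e \<circ> x" "\<forall>i. x i \<in> A" "\<forall>i\<ge>m. x i = c" by (auto simp: fin_seq_def)
  then show "w \<in> fin_seq (e ` A) (e c)" by (auto simp: fin_seq_def intro!: exI[of _ m])
qed

lemma hr_space_fin_seq:
  fixes S :: "(nat \<Rightarrow> nat) set"
  assumes "\<bb> \<le>o cov_meager" "b_scale S" "Y = to_ext ` S \<union> Q_inf" "q \<in> Y"
  shows "hr_space (top_of_set (fin_seq Y q))"
proof -
  have eq: "fin_seq Y q = (\<Union>m. mixed Y {\<lambda>_. q} {..<m})"
  proof -
    have "(\<exists>m. x \<in> mixed Y {\<lambda>_. q} {..<m}) \<longleftrightarrow> x \<in> fin_seq Y q" for x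
    proof -
      have "(\<forall>i<m. x i \<in> Y) \<and> (\<forall>i\<ge>m. x i = q) \<longleftrightarrow> (\<forall>i. x i \<in> Y) \<and> (\<forall>i\<ge>m. x i = q)" for m
        using assms(4) not_less by metis
      moreover have "x \<in> mixed Y {\<lambda>_. q} {..<m} \<longleftrightarrow> (\<forall>i<m. x i \<in> Y) \<and> (\<forall>i\<ge>m. x i = q)" for m
        by (auto simp: mixed_def not_less)
      ultimately have "x \<in> mixed Y {\<lambda>_. q} {..<m} \<longleftrightarrow> (\<forall>i. x i \<in> Y) \<and> (\<forall>i\<ge>m. x i = q)" for m
        by simp
      then show ?thesis by (simp add: fin_seq_def)
    qed
    then show ?thesis by auto
  qed
  show ?thesis
    unfolding eq
    by (intro hr_space_countable_Union hr_space_mixed[OF assms(1-3)] card_less_bounding_if_countable)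
      simp_all
qed

text \<open>
  Division is replaced by \<open>v / max (v * v) (1 / (k + 1))\<close>, which is continuous everywhere, takes
  values in the field generated by \<open>v\<close>, and is \<open>1 / v\<close> for large \<open>k\<close>.
\<close>

datatype 'v rterm = Var 'v | Const rat | Add "'v rterm" "'v rterm" | Mul "'v rterm" "'v rterm"
  | Inv nat "'v rterm"

instance rterm :: (countable) countable
  by countable_datatype

primrec reval :: "'v rterm \<Rightarrow> ('v \<Rightarrow> real) \<Rightarrow> real" where
  "reval (Var v) x = x v"
| "reval (Const r) x = of_rat r"
| "reval (Add s t) x = reval s x + reval t x"
| "reval (Mul s t) x = reval s x * reval t x"
| "reval (Inv k t) x = reval t x / max (reval t x * reval t x) (1 / (real k + 1))"

lemma reval_map: "reval (map_rterm h t) x = reval t (x \<circ> h)"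
  by (induction t) simp_all

lemma continuous_map_reval:
  assumes "\<And>v. continuous_map T euclideanreal (\<lambda>p. x p v)"
  shows "continuous_map T euclideanreal (\<lambda>p. reval t (x p))"
proof (induction t)
  case (Inv k t)
  have "0 < max u (1 / (real k + 1))" for u :: real
    by (rule less_le_trans[OF _ max.cobounded2]) simp
  then have "max u (1 / (real k + 1)) \<noteq> 0" for u :: real
    using less_imp_neq by metis
  then show ?case unfolding reval.simps
    by (intro continuous_map_real_divide continuous_map_real_max continuous_map_real_mult Inv) simp_all
qed (simp_all add: assms continuous_map_add continuous_map_real_mult)

section \<open>Field elements as values of terms\<close>

lemma rat_adjoin_closed:
  shows "r \<in> \<rat> \<Longrightarrow> r \<in> rat_adjoin A" and "r \<in> A \<Longrightarrow> r \<in> rat_adjoin A"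
    and "r \<in> rat_adjoin A \<Longrightarrow> s \<in> rat_adjoin A \<Longrightarrow> r + s \<in> rat_adjoin A"
    and "r \<in> rat_adjoin A \<Longrightarrow> s \<in> rat_adjoin A \<Longrightarrow> r * s \<in> rat_adjoin A"
    and "r \<in> rat_adjoin A \<Longrightarrow> inverse r \<in> rat_adjoin A"
proof -
  let ?R = "ring_of_type_algebra :: real ring"
  interpret field ?R by (rule field_from_type_algebra)
  have R: "r \<otimes>\<^bsub>?R\<^esub> s = r * s" "\<one>\<^bsub>?R\<^esub> = 1" "\<zero>\<^bsub>?R\<^esub> = 0" "r \<in> carrier ?R" for r s
    by (simp_all add: ring_of_type_algebra_def)
  show rat: "r \<in> rat_adjoin A" if "r \<in> \<rat>" for r 
    unfolding rat_adjoin_def by (rule generate_field.incl) (simp add: that)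
  show "r \<in> rat_adjoin A" if "r \<in> A" for r 
    unfolding rat_adjoin_def by (rule generate_field.incl) (simp add: that)
  show "r + s \<in> rat_adjoin A" if "r \<in> rat_adjoin A" "s \<in> rat_adjoin A" for r s
    using generate_field.eng_add[of r ?R _ s] that
    unfolding rat_adjoin_def by (simp add: ring_of_type_algebra_def)
  show "r * s \<in> rat_adjoin A" if "r \<in> rat_adjoin A" "s \<in> rat_adjoin A" for r s
    using generate_field.eng_mult[of r ?R _ s] that
    unfolding rat_adjoin_def by (simp add: R)
  show "inverse r \<in> rat_adjoin A" if r: "r \<in> rat_adjoin A" for r
  proof (cases "r = 0")
    case False
    then have "inv\<^bsub>?R\<^esub> r = inverse r" by (intro comm_inv_char) (simp_all add: R)
    then show ?thesis
      using generate_field.m_inv[of r ?R] r False unfolding rat_adjoin_def by (simp add: R)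
  qed (simp add: rat)
qed

lemma rat_adjoin_induct [consumes 1, case_names rat incl minus inverse add mult]:
  assumes "r \<in> rat_adjoin A"
    and "\<And>r. r \<in> \<rat> \<Longrightarrow> P r" "\<And>r. r \<in> A \<Longrightarrow> P r" "\<And>r. P r \<Longrightarrow> P (- r)"
    and "\<And>r. P r \<Longrightarrow> r \<noteq> 0 \<Longrightarrow> P (inverse r)"
    and "\<And>r s. P r \<Longrightarrow> P s \<Longrightarrow> P (r + s)" "\<And>r s. P r \<Longrightarrow> P s \<Longrightarrow> P (r * s)"
  shows "P r"
proof -
  let ?R = "ring_of_type_algebra :: real ring"
  interpret field ?R by (rule field_from_type_algebra)
  have R: "r \<otimes>\<^bsub>?R\<^esub> s = r * s" "r \<oplus>\<^bsub>?R\<^esub> s = r + s" "\<one>\<^bsub>?R\<^esub> = 1" "\<zero>\<^bsub>?R\<^esub> = 0"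
    "r \<in> carrier ?R" for r s
    by (simp_all add: ring_of_type_algebra_def)
  have minus: "\<ominus>\<^bsub>?R\<^esub> r = - r" for r by (rule minus_equality) (simp_all add: R)
  have inverse: "inv\<^bsub>?R\<^esub> r = inverse r" if "r \<noteq> 0" for r
    using that by (intro comm_inv_char) (simp_all add: R)
  from assms(1) show ?thesis unfolding rat_adjoin_def
  proof (induction rule: generate_field.induct)
    case (m_inv h)
    then have "h \<noteq> 0" by (simp add: R)
    then show ?case using assms(5)[OF m_inv.IH] inverse by simp
  qed (use assms(2-7) in \<open>auto simp: R minus\<close>)
qed

text \<open>In the \<open>Inv\<close> case the maximum is one of its two arguments, and both lie in
  the field.\<close>

lemma reval_in_rat_adjoin:
  assumes "\<And>v. x v \<in> A"
  shows "reval t x \<in> rat_adjoin A"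
proof (induction t)
  case (Inv k t)
  let ?v = "reval t x"
  have "1 / (real k + 1) \<in> rat_adjoin A" by (intro rat_adjoin_closed(1)) simp
  then have "inverse (max (?v * ?v) (1 / (real k + 1))) \<in> rat_adjoin A"
    using rat_adjoin_closed(4,5)[OF Inv] rat_adjoin_closed(4)[OF Inv Inv]
    by (intro rat_adjoin_closed(5)) (simp add: max_def)
  then show ?case using rat_adjoin_closed(4)[OF Inv] by (simp add: divide_inverse)
qed (use assms in \<open>auto intro: rat_adjoin_closed\<close>)

text \<open>The argument sequences become rows 0 and 1 of a merged one, and variables are renamed to
  read their own row.\<close>

lemma reval_common_args:
  assumes "c \<in> A" "\<exists>t. \<exists>x\<in>fin_seq A c. r = reval (t :: nat rterm) x"
    and "\<exists>t. \<exists>x\<in>fin_seq A c. s = reval (t :: nat rterm) x"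
  shows "\<exists>t t'. \<exists>z\<in>fin_seq A c. r = reval (t :: nat rterm) z \<and> s = reval (t' :: nat rterm) z"
proof -
  obtain t x where x: "x \<in> fin_seq A c" "r = reval (t :: nat rterm) x" using assms(2) by blast
  obtain t' x' where x': "x' \<in> fin_seq A c" "s = reval (t' :: nat rterm) x'" using assms(3) by blast
  have "(if i = 0 then x else x') \<in> fin_seq A c" for i :: nat using x(1) x'(1) by simp
  from fin_seq_merge[OF assms(1) this, of 2] obtain z where z: "z \<in> fin_seq A c"
    "\<forall>i<2. \<forall>n. z (prod_encode (i, n)) = (if i = 0 then x else x') n" ..
  have "z \<circ> (\<lambda>n. prod_encode (0, n)) = x" "z \<circ> (\<lambda>n. prod_encode (1, n)) = x'"
    using z(2) by auto
  then have "r = reval (map_rterm (\<lambda>n. prod_encode (0, n)) t) z"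
    "s = reval (map_rterm (\<lambda>n. prod_encode (1, n)) t') z"
    unfolding reval_map x(2) x'(2) by simp_all
  then show ?thesis using z(1) by blast
qed

lemma rat_adjoin_imp_reval:
  assumes "r \<in> rat_adjoin A" "c \<in> A"
  shows "\<exists>t. \<exists>x\<in>fin_seq A c. r = reval (t :: nat rterm) x"
  using assms(1)
proof (induction rule: rat_adjoin_induct)
  case (rat r)
  then obtain a where "r = of_rat a" by (elim Rats_cases)
  then have "r = reval (Const a) (\<lambda>_. c)" by simp
  moreover have "(\<lambda>_. c) \<in> fin_seq A c" using assms(2) by (simp add: fin_seq_def)
  ultimately show ?case by blast
next
  case (incl r)
  define x where "x i = (if i = 0 then r else c)" for i :: nat
  have "x \<in> fin_seq A c" using assms(2) incl by (auto simp: fin_seq_def x_def intro: exI[of _ 1])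
  moreover have "r = reval (Var 0) x" by (simp add: x_def)
  ultimately show ?case by blast
next
  case (minus r)
  then obtain t x where x: "x \<in> fin_seq A c" and "r = reval (t :: nat rterm) x" by blast
  then have "- r = reval (Mul (Const (- 1)) t) x" by simp
  with x show ?case by blast
next
  case (inverse r)
  then obtain t x where x: "x \<in> fin_seq A c" and r: "r = reval (t :: nat rterm) x" by blast
  obtain k where "inverse (real (Suc k)) < r * r"
    using reals_Archimedean[of "r * r"] inverse.hyps by (auto simp: zero_less_mult_iff linorder_neq_iff)
  then have "max (r * r) (1 / (real k + 1)) = r * r" by (simp add: inverse_eq_divide add.commute max_def)
  then have "inverse r = reval (Inv k t) x"
    using inverse.hyps by (simp add: r[symmetric] field_simps)
  with x show ?case by blast
next
  case (add r s)
  from reval_common_args[OF assms(2) this] obtain t t' z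
    where z: "z \<in> fin_seq A c" and "r = reval (t :: nat rterm) z" "s = reval (t' :: nat rterm) z" by blast
  then have "r + s = reval (Add t t') z" by simp
  with z show ?case by blast
next
  case (mult r s)
  from reval_common_args[OF assms(2) this] obtain t t' z
    where z: "z \<in> fin_seq A c" and "r = reval (t :: nat rterm) z" "s = reval (t' :: nat rterm) z" by blast
  then have "r * s = reval (Mul t t') z" by simp
  with z show ?case by blast
qed

lemma hr_space_finite_power_rat_adjoin:
  fixes e :: "(nat \<Rightarrow> enat) \<Rightarrow> real"
  assumes "\<bb> \<le>o cov_meager" "b_scale S" and Y: "Y = to_ext ` S \<union> Q_inf"
    and e: "continuous_map (top_of_set ext_incr) euclideanreal e"
  shows "hr_space (finite_power (top_of_set (rat_adjoin (e ` Y))) k)"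
proof -
  \<comment> \<open>The constant \<infinity> belongs to \<open>Q_inf\<close> and so can pad
    sequences for any scale.\<close>
  define q :: "nat \<Rightarrow> enat" where "q = (\<lambda>_. \<infinity>)"
  have q: "q \<in> Y" by (auto simp: Y Q_inf_def ext_incr_def q_def mono_def)
  have "strict_mono f" if "f \<in> S" for f using assms(2) that by (auto simp: b_scale_def)
  then have Y_ext: "Y \<subseteq> ext_incr" using to_ext_in_ext_incr Q_inf_subset_ext_incr by (auto simp: Y)
  let ?T = "top_of_set (fin_seq Y q)"
  \<comment> \<open>Component i evaluates the i-th term at row i of \<open>x\<close>. Lists give a
    countable index type; on a list shorter than \<open>k\<close>, \<open>ts ! i\<close> is still
    some term, so values stay in the field.\<close>
  define F where "F ts x = restrict (\<lambda>i. reval (ts ! i) (\<lambda>n. e (x (prod_encode (i, n))))) {..<k}"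
    for ts :: "nat rterm list" and x
  have hr: "hr_space ?T" using assms(1-3) q by (rule hr_space_fin_seq)
  have in_K: "reval t (\<lambda>n. e (x (h n))) \<in> rat_adjoin (e ` Y)" if "x \<in> fin_seq Y q"
    for t :: "nat rterm" and x and h :: "nat \<Rightarrow> nat"
    using that by (intro reval_in_rat_adjoin) (auto simp: fin_seq_def)
  have proj: "continuous_map ?T (top_of_set ext_incr) (\<lambda>x. x j)" for j
  proof -
    have "continuous_on (fin_seq Y q) (\<lambda>x. x j)"
      by (rule continuous_on_subset[OF continuous_on_product_coordinates]) simp
    then show ?thesis using Y_ext by (auto simp: continuous_map_in_subtopology fin_seq_def)
  qed
  have "continuous_map ?T euclideanreal (\<lambda>x. e (x j))" for j
    using continuous_map_compose[OF proj e] by (simp add: o_def)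
  then have cont: "continuous_map ?T euclideanreal (\<lambda>x. reval (t :: nat rterm) (\<lambda>n. e (x (h n))))"
    for t and h :: "nat \<Rightarrow> nat"
    by (rule continuous_map_reval)
  show ?thesis
  proof (rule hr_space_countable_Union_images[OF hr])
    show "continuous_map ?T (finite_power (top_of_set (rat_adjoin (e ` Y))) k) (F ts)" for ts
      unfolding finite_power_def continuous_map_componentwise
      using cont in_K by (auto simp: F_def continuous_map_in_subtopology)
    show "topspace (finite_power (top_of_set (rat_adjoin (e ` Y))) k) = (\<Union>ts. F ts ` topspace ?T)"
    proof (intro equalityI subsetI)
      fix y assume "y \<in> topspace (finite_power (top_of_set (rat_adjoin (e ` Y))) k)"
      then have y: "y \<in> PiE {..<k} (\<lambda>_. rat_adjoin (e ` Y))" by (simp add: finite_power_def)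
      have "\<exists>t. \<exists>w\<in>fin_seq (e ` Y) (e q). i < k \<longrightarrow> y i = reval (t :: nat rterm) w" for i
      proof (cases "i < k")
        case True
        then show ?thesis using rat_adjoin_imp_reval[of "y i" "e ` Y" "e q"] y q by blast
      next
        case False
        have "(\<lambda>_. e q) \<in> fin_seq (e ` Y) (e q)" using q by (auto simp: fin_seq_def)
        then show ?thesis using False by blast
      qed
      then obtain t w where tw: "\<And>i. w i \<in> fin_seq (e ` Y) (e q)"
        "\<And>i. i < k \<Longrightarrow> y i = reval (t i :: nat rterm) (w i)" by metis
      obtain z where z: "z \<in> fin_seq (e ` Y) (e q)" "\<And>i n. i < k \<Longrightarrow> z (prod_encode (i, n)) = w i n"
        using fin_seq_merge[of "e q" "e ` Y" k w] q tw(1) by blast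
      obtain x where x: "x \<in> fin_seq Y q" "z = e \<circ> x" using z(1) fin_seq_image[OF q, of e] by blast
      have xw: "(\<lambda>n. e (x (prod_encode (i, n)))) = w i" if "i < k" for i
        using z(2)[OF that] by (simp add: x(2) fun_eq_iff)
      have "y = F (map t [0..<k]) x"
      proof
        fix i
        show "y i = F (map t [0..<k]) x i"
        proof (cases "i < k")
          case True
          then show ?thesis using xw[OF True] tw(2)[OF True] by (simp add: F_def)
        next
          case False
          then show ?thesis using PiE_arb[OF y, of i] by (simp add: F_def)
        qed
      qed
      then show "y \<in> (\<Union>ts. F ts ` topspace ?T)" using x(1) by auto
    next
      fix y assume "y \<in> (\<Union>ts. F ts ` topspace ?T)"
      then obtain ts x where "x \<in> fin_seq Y q" "y = F ts x" by auto
      then show "y \<in> topspace (finite_power (top_of_set (rat_adjoin (e ` Y))) k)"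
        using in_K unfolding F_def by (auto simp: finite_power_def)
    qed
  qed
qed

theorem theorem10p2:
  fixes e :: "(nat \<Rightarrow> enat) \<Rightarrow> real" and S :: "(nat \<Rightarrow> nat) set" and XR :: "real set"
    and K :: "real topology"
  assumes "\<bb> \<le>o cov_meager"
    and "embedding_map (top_of_set ext_incr) euclideanreal e"
    and "b_scale S"
    and "XR = e ` (to_ext ` S \<union> Q_inf)"
    and "K = top_of_set (rat_adjoin XR)"
  shows "S1 (omega_covers K) (gp_omega_covers K) \<and>
    (\<forall>k. hurewicz_property (finite_power K k) \<and> rothberger_property (finite_power K k))"
proof -
  have "continuous_map (top_of_set ext_incr) euclideanreal e"
    using assms(2) homeomorphic_imp_continuous_map continuous_map_in_subtopology
    unfolding embedding_map_def by blast
  then have hr: "hr_space (finite_power K k)" for k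
    unfolding assms(4,5) using assms(1,3) by (intro hr_space_finite_power_rat_adjoin) auto
  \<comment> \<open>The point 0 makes every finite power nonempty, as the passage to the Rothberger
    property requires.\<close>
  have "0 \<in> topspace K" using rat_adjoin_closed(1)[of 0 XR] assms(5) by simp
  then have "topspace (finite_power K k) \<noteq> {}" for k
    by (auto simp: finite_power_def PiE_eq_empty_iff)
  then show ?thesis
    using hr S1_groupable hr_space_imp_hurewicz hr_space_imp_rothberger by blast
qed

end
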